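(* Let $0\to\mathsf{M}_1\xrightarrow{f}\mathsf{M}_2\xrightarrow{g}\mathsf{M}_3\to0$ be a short exact sequence of algebras with bracket (AWBs). Let $\mathsf{N}$ be an AWB together with compatible actions of $\mathsf{N}$ and $\mathsf{M}_i$ ($i=1,2,3$) on each other, and suppose that $f$ and $g$ preserve these actions. Then there is an exact sequence of AWBs $$\mathsf{M}_1\boxtimes\mathsf{N}\xrightarrow{\,f\boxtimes\mathrm{Id}_{\mathsf{N}}\,}\mathsf{M}_2\boxtimes\mathsf{N}\xrightarrow{\,g\boxtimes\mathrm{Id}_{\mathsf{N}}\,}\mathsf{M}_3\boxtimes\mathsf{N}\to0,$$ where $\boxtimes$ denotes the non-abelian tensor product of AWBs.
   Context: All vector spaces and algebras are over a fixed field $\mathbb{K}$. An algebra with bracket (AWB) is an associative, not necessarily commutative (and not necessarily unital) algebra $\mathsf{A}$ with a bilinear map $[-,-]:\mathsf{A}\times\mathsf{A}\to\mathsf{A}$ such that $[ab,c]=[a,c]b+a[b,c]$ for all $a,b,c$. Homomorphisms preserve product and bracket. Action: an action of an AWB $\mathsf{A}$ on an AWB $\mathsf{M}$ consists of four bilinear maps $(a,m)\mapsto{}^{a\cdot}m$, $(m,a)\mapsto m^{\cdot a}$, $(a,m)\mapsto{}^{a\ast}m$, $(m,a)\mapsto m^{\ast a}$ with values in $\mathsf{M}$ such that for all $a,a_1,a_2\in\mathsf{A}$, $m,m_1,m_2\in\mathsf{M}$: ${}^{(a_1a_2)\cdot}m={}^{a_1\cdot}({}^{a_2\cdot}m)$;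 $\ m^{\cdot(a_1a_2)}=(m^{\cdot a_1})^{\cdot a_2}$; $\ ({}^{a_1\cdot}m)^{\cdot a_2}={}^{a_1\cdot}(m^{\cdot a_2})$; $({}^{a_1\cdot}m)^{\ast a_2}={}^{a_1\cdot}(m^{\ast a_2})+{}^{[a_1,a_2]\cdot}m$; $\ (m^{\cdot a_1})^{\ast a_2}=(m^{\ast a_2})^{\cdot a_1}+m^{\cdot[a_1,a_2]}$; $\ {}^{(a_1a_2)\ast}m={}^{a_1\cdot}({}^{a_2\ast}m)+({}^{a_1\ast}m)^{\cdot a_2}$; $(m_1m_2)^{\cdot a}=m_1(m_2^{\cdot a})$; $\ {}^{a\cdot}(m_1m_2)=({}^{a\cdot}m_1)m_2$; $\ (m_1^{\cdot a})m_2=m_1({}^{a\cdot}m_2)$; $[m_1^{\cdot a},m_2]=m_1({}^{a\ast}m_2)+[m_1,m_2]^{\cdot a}$; $\ [{}^{a\cdot}m_1,m_2]={}^{a\cdot}[m_1,m_2]+({}^{a\ast}m_2)m_1$; $\ (m_1m_2)^{\ast a}=m_1(m_2^{\ast a})+(m_1^{\ast a})m_2$. Let $\mathsf{M},\mathsf{N}$ be AWBs with mutual actions on each other. Call a pair $(u_{\mathsf{M}},u_{\mathsf{N}})\in\mathsf{M}\times\mathsf{N}$ basic if it is one of $(m^{\cdot n},{}^{m\cdot}n)$, $({}^{n\cdot}m,n^{\cdot m})$, $(m^{\ast n},{}^{m\ast}n)$, $({}^{n\ast}m,n^{\ast m})$ for some $m\in\mathsf{M}$, $n\in\mathsf{N}$.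 Compatible actions: the actions are compatible if for every basic pair $(u_{\mathsf{M}},u_{\mathsf{N}})$ and all $m\in\mathsf{M}$, $n\in\mathsf{N}$: $m^{\cdot u_{\mathsf{N}}}=m\,u_{\mathsf{M}}$, $\ m^{\ast u_{\mathsf{N}}}=[m,u_{\mathsf{M}}]$, $\ {}^{u_{\mathsf{M}}\cdot}n=u_{\mathsf{N}}\,n$, $\ {}^{u_{\mathsf{M}}\ast}n=[u_{\mathsf{N}},n]$, and symmetrically $n^{\cdot u_{\mathsf{M}}}=n\,u_{\mathsf{N}}$, $\ n^{\ast u_{\mathsf{M}}}=[n,u_{\mathsf{N}}]$, $\ {}^{u_{\mathsf{N}}\cdot}m=u_{\mathsf{M}}\,m$, $\ {}^{u_{\mathsf{N}}\ast}m=[u_{\mathsf{M}},m]$. Non-abelian tensor product $\mathsf{M}\boxtimes\mathsf{N}$ (for compatible actions): it is the vector space spanned by formal symbols $m\odot n$, $n\odot m$, $m\circledast n$, $n\circledast m$ for $m\in\mathsf{M}$, $n\in\mathsf{N}$ (four formally distinct families, also when $\mathsf{M}$ and $\mathsf{N}$ have elements in common), modulo the following relations, for all $\lambda\in\mathbb{K}$ and all elements, where $\star$ stands for either of $\odot$, $\circledast$: (1) $\lambda(m\star n)=(\lambda m)\star n=m\star(\lambda n)$, $(m+m')\star n=m\star n+m'\star n$, $m\star(n+n')=m\star n+m\star n'$; (2) $u_{\mathsf{M}}\star v_{\mathsf{N}}=u_{\mathsf{N}}\star v_{\mathsf{M}}$ for all basic pairs $(u_{\mathsf{M}},u_{\mathsf{N}})$,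 $(v_{\mathsf{M}},v_{\mathsf{N}})$; (3) $(m_1m_2)\odot n=m_1\odot({}^{m_2\cdot}n)$; $\ n\odot(m_1m_2)=(n^{\cdot m_1})\odot m_2$; $\ (m_1m_2)\circledast n=m_1\odot({}^{m_2\ast}n)+({}^{m_1\ast}n)\odot m_2$; $\ ({}^{m_1\cdot}n)\circledast m_2=m_1\odot(n^{\ast m_2})+[m_1,m_2]\odot n$; $\ (n^{\cdot m_1})\circledast m_2=(n^{\ast m_2})\odot m_1+n\odot[m_1,m_2]$; $\ ({}^{m_1\cdot}n)\odot m_2=m_1\odot(n^{\cdot m_2})$; (4) all relations obtained from (1) and (3) by exchanging the roles of elements of $\mathsf{M}$ and $\mathsf{N}$. To each generator $g$ associate a basic pair $(g_{\mathsf{M}},g_{\mathsf{N}})$: $m\odot n\mapsto(m^{\cdot n},{}^{m\cdot}n)$, $n\odot m\mapsto({}^{n\cdot}m,n^{\cdot m})$, $m\circledast n\mapsto(m^{\ast n},{}^{m\ast}n)$, $n\circledast m\mapsto({}^{n\ast}m,n^{\ast m})$. The AWB structure on $\mathsf{M}\boxtimes\mathsf{N}$ is given on generators by $g\,h=g_{\mathsf{M}}\odot h_{\mathsf{N}}$ and $[g,h]=g_{\mathsf{M}}\circledast h_{\mathsf{N}}$. Functoriality: AWB homomorphisms $\phi:\mathsf{M}\to\mathsf{M}'$, $\gamma:\mathsf{N}\to\mathsf{N}'$ (with compatible mutual actions of $\mathsf{M},\mathsf{N}$ and of $\mathsf{M}',\mathsf{N}'$) preserve the actions if $\phi({}^{n\cdot}m)={}^{\gamma(n)\cdot}\phi(m)$,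 $\phi(m^{\cdot n})=\phi(m)^{\cdot\gamma(n)}$, $\phi({}^{n\ast}m)={}^{\gamma(n)\ast}\phi(m)$, $\phi(m^{\ast n})=\phi(m)^{\ast\gamma(n)}$, and $\gamma({}^{m\cdot}n)={}^{\phi(m)\cdot}\gamma(n)$, $\gamma(n^{\cdot m})=\gamma(n)^{\cdot\phi(m)}$, $\gamma({}^{m\ast}n)={}^{\phi(m)\ast}\gamma(n)$, $\gamma(n^{\ast m})=\gamma(n)^{\ast\phi(m)}$ for all $m,n$. Then $\phi\boxtimes\gamma:\mathsf{M}\boxtimes\mathsf{N}\to\mathsf{M}'\boxtimes\mathsf{N}'$ is the AWB homomorphism $m\odot n\mapsto\phi(m)\odot\gamma(n)$, $n\odot m\mapsto\gamma(n)\odot\phi(m)$, $m\circledast n\mapsto\phi(m)\circledast\gamma(n)$, $n\circledast m\mapsto\gamma(n)\circledast\phi(m)$. "$f$ and $g$ preserve these actions" means that the pairs $(f,\mathrm{Id}_{\mathsf{N}})$ and $(g,\mathrm{Id}_{\mathsf{N}})$ preserve the actions in this sense. *)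

theory Defs
  imports "HOL.Hull" "HOL-Algebra.Module" "HOL-Algebra.QuotRing"
begin

section \<open>Algebras with bracket\<close>

text \<open>
  Objects are records over explicit carriers, so that the tensor product is an object of the same
  kind as its arguments.  The record field \<open>one\<close> inherited from \<^type>\<open>ring\<close> carries no meaning: algebras
  with bracket are not assumed to be unital.
\<close>

record ('k, 'a) awb = "('k, 'a) module" +
  bracket :: "'a \<Rightarrow> 'a \<Rightarrow> 'a"  (\<open>\<lbrace>_, _\<rbrace>\<index>\<close>)

definition bilinear_on ::
  "('k, 'r) ring_scheme \<Rightarrow> ('k, 'u, 'x) module_scheme \<Rightarrow> ('k, 'v, 'y) module_scheme \<Rightarrow>
   ('k, 'w, 'z) module_scheme \<Rightarrow> ('u \<Rightarrow> 'v \<Rightarrow> 'w) \<Rightarrow> bool"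
  where "bilinear_on K U V W b \<longleftrightarrow>
    (\<forall>u\<in>carrier U. \<forall>v\<in>carrier V. b u v \<in> carrier W) \<and>
    (\<forall>u\<in>carrier U. \<forall>u'\<in>carrier U. \<forall>v\<in>carrier V.
       b (u \<oplus>\<^bsub>U\<^esub> u') v = b u v \<oplus>\<^bsub>W\<^esub> b u' v) \<and>
    (\<forall>u\<in>carrier U. \<forall>v\<in>carrier V. \<forall>v'\<in>carrier V.
       b u (v \<oplus>\<^bsub>V\<^esub> v') = b u v \<oplus>\<^bsub>W\<^esub> b u v') \<and>
    (\<forall>k\<in>carrier K. \<forall>u\<in>carrier U. \<forall>v\<in>carrier V.
       b (k \<odot>\<^bsub>U\<^esub> u) v = k \<odot>\<^bsub>W\<^esub> b u v \<and> b u (k \<odot>\<^bsub>V\<^esub> v) = k \<odot>\<^bsub>W\<^esub> b u v)"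

locale awb = module K A + field K
  for K :: "('k, 'r) ring_scheme" (structure) and A :: "('k, 'a) awb" (structure) +
  assumes mult_bilinear: "bilinear_on K A A A (mult A)"
    and bracket_bilinear: "bilinear_on K A A A (bracket A)"
    and mult_assoc: "\<lbrakk>a \<in> carrier A; b \<in> carrier A; c \<in> carrier A\<rbrakk> \<Longrightarrow>
      (a \<otimes>\<^bsub>A\<^esub> b) \<otimes>\<^bsub>A\<^esub> c = a \<otimes>\<^bsub>A\<^esub> (b \<otimes>\<^bsub>A\<^esub> c)"
    and bracket_mult: "\<lbrakk>a \<in> carrier A; b \<in> carrier A; c \<in> carrier A\<rbrakk> \<Longrightarrow>
      \<lbrace>a \<otimes>\<^bsub>A\<^esub> b, c\<rbrace>\<^bsub>A\<^esub> = \<lbrace>a, c\<rbrace>\<^bsub>A\<^esub> \<otimes>\<^bsub>A\<^esub> b \<oplus>\<^bsub>A\<^esub> a \<otimes>\<^bsub>A\<^esub> \<lbrace>b, c\<rbrace>\<^bsub>A\<^esub>"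

definition awb_hom ::
  "('k, 'r) ring_scheme \<Rightarrow> ('k, 'a) awb \<Rightarrow> ('k, 'b) awb \<Rightarrow> ('a \<Rightarrow> 'b) set"
  where "awb_hom K A B = {h. h \<in> carrier A \<rightarrow> carrier B \<and>
    (\<forall>x\<in>carrier A. \<forall>y\<in>carrier A.
       h (x \<oplus>\<^bsub>A\<^esub> y) = h x \<oplus>\<^bsub>B\<^esub> h y \<and>
       h (x \<otimes>\<^bsub>A\<^esub> y) = h x \<otimes>\<^bsub>B\<^esub> h y \<and>
       h \<lbrace>x, y\<rbrace>\<^bsub>A\<^esub> = \<lbrace>h x, h y\<rbrace>\<^bsub>B\<^esub>) \<and>
    (\<forall>k\<in>carrier K. \<forall>x\<in>carrier A. h (k \<odot>\<^bsub>A\<^esub> x) = k \<odot>\<^bsub>B\<^esub> h x)}"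

text \<open>Exactness of \<open>A \<rightarrow> B \<rightarrow> C \<rightarrow> 0\<close> and of \<open>0 \<rightarrow> A \<rightarrow> B \<rightarrow> C \<rightarrow> 0\<close> as sequences of algebras with bracket.\<close>

definition awb_right_exact ::
  "('k, 'r) ring_scheme \<Rightarrow> ('k, 'a) awb \<Rightarrow> ('k, 'b) awb \<Rightarrow> ('k, 'c) awb \<Rightarrow>
   ('a \<Rightarrow> 'b) \<Rightarrow> ('b \<Rightarrow> 'c) \<Rightarrow> bool"
  where "awb_right_exact K A B C f g \<longleftrightarrow>
    awb K A \<and> awb K B \<and> awb K C \<and> f \<in> awb_hom K A B \<and> g \<in> awb_hom K B C \<and>
    f ` carrier A = a_kernel B C g \<and> g ` carrier B = carrier C"

definition awb_short_exact ::
  "('k, 'r) ring_scheme \<Rightarrow> ('k, 'a) awb \<Rightarrow> ('k, 'b) awb \<Rightarrow> ('k, 'c) awb \<Rightarrow>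
   ('a \<Rightarrow> 'b) \<Rightarrow> ('b \<Rightarrow> 'c) \<Rightarrow> bool"
  where "awb_short_exact K A B C f g \<longleftrightarrow>
    awb_right_exact K A B C f g \<and> a_kernel A B f = {\<zero>\<^bsub>A\<^esub>}"


section \<open>Actions\<close>

text \<open>
  An action of \<open>A\<close> on \<open>M\<close>, with \<open>ldot \<alpha> a m\<close>, \<open>rdot \<alpha> m a\<close>, \<open>lstar \<alpha> a m\<close>, \<open>rstar \<alpha> m a\<close> standing for
  the elements usually written with a left superscript \<open>a\<cdot>\<close>, a right superscript \<open>\<cdot>a\<close>, a left
  superscript \<open>a*\<close> and a right superscript \<open>*a\<close> on \<open>m\<close>.
\<close>

record ('a, 'm) awb_action =
  ldot :: "'a \<Rightarrow> 'm \<Rightarrow> 'm"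
  rdot :: "'m \<Rightarrow> 'a \<Rightarrow> 'm"
  lstar :: "'a \<Rightarrow> 'm \<Rightarrow> 'm"
  rstar :: "'m \<Rightarrow> 'a \<Rightarrow> 'm"

definition acts_on ::
  "('k, 'r) ring_scheme \<Rightarrow> ('k, 'a) awb \<Rightarrow> ('k, 'm) awb \<Rightarrow> ('a, 'm) awb_action \<Rightarrow> bool"
  where "acts_on K A M \<alpha> \<longleftrightarrow>
    bilinear_on K A M M (ldot \<alpha>) \<and> bilinear_on K M A M (rdot \<alpha>) \<and>
    bilinear_on K A M M (lstar \<alpha>) \<and> bilinear_on K M A M (rstar \<alpha>) \<and>
    (\<forall>a1\<in>carrier A. \<forall>a2\<in>carrier A. \<forall>m\<in>carrier M.
       ldot \<alpha> (a1 \<otimes>\<^bsub>A\<^esub> a2) m = ldot \<alpha> a1 (ldot \<alpha> a2 m) \<and>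
       rdot \<alpha> m (a1 \<otimes>\<^bsub>A\<^esub> a2) = rdot \<alpha> (rdot \<alpha> m a1) a2 \<and>
       rdot \<alpha> (ldot \<alpha> a1 m) a2 = ldot \<alpha> a1 (rdot \<alpha> m a2) \<and>
       rstar \<alpha> (ldot \<alpha> a1 m) a2 = ldot \<alpha> a1 (rstar \<alpha> m a2) \<oplus>\<^bsub>M\<^esub> ldot \<alpha> \<lbrace>a1, a2\<rbrace>\<^bsub>A\<^esub> m \<and>
       rstar \<alpha> (rdot \<alpha> m a1) a2 = rdot \<alpha> (rstar \<alpha> m a2) a1 \<oplus>\<^bsub>M\<^esub> rdot \<alpha> m \<lbrace>a1, a2\<rbrace>\<^bsub>A\<^esub> \<and>
       lstar \<alpha> (a1 \<otimes>\<^bsub>A\<^esub> a2) m = ldot \<alpha> a1 (lstar \<alpha> a2 m) \<oplus>\<^bsub>M\<^esub> rdot \<alpha> (lstar \<alpha> a1 m) a2) \<and>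
    (\<forall>a\<in>carrier A. \<forall>m1\<in>carrier M. \<forall>m2\<in>carrier M.
       rdot \<alpha> (m1 \<otimes>\<^bsub>M\<^esub> m2) a = m1 \<otimes>\<^bsub>M\<^esub> rdot \<alpha> m2 a \<and>
       ldot \<alpha> a (m1 \<otimes>\<^bsub>M\<^esub> m2) = ldot \<alpha> a m1 \<otimes>\<^bsub>M\<^esub> m2 \<and>
       rdot \<alpha> m1 a \<otimes>\<^bsub>M\<^esub> m2 = m1 \<otimes>\<^bsub>M\<^esub> ldot \<alpha> a m2 \<and>
       \<lbrace>rdot \<alpha> m1 a, m2\<rbrace>\<^bsub>M\<^esub> = m1 \<otimes>\<^bsub>M\<^esub> lstar \<alpha> a m2 \<oplus>\<^bsub>M\<^esub> rdot \<alpha> \<lbrace>m1, m2\<rbrace>\<^bsub>M\<^esub> a \<and>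
       \<lbrace>ldot \<alpha> a m1, m2\<rbrace>\<^bsub>M\<^esub> = ldot \<alpha> a \<lbrace>m1, m2\<rbrace>\<^bsub>M\<^esub> \<oplus>\<^bsub>M\<^esub> lstar \<alpha> a m2 \<otimes>\<^bsub>M\<^esub> m1 \<and>
       rstar \<alpha> (m1 \<otimes>\<^bsub>M\<^esub> m2) a = m1 \<otimes>\<^bsub>M\<^esub> rstar \<alpha> m2 a \<oplus>\<^bsub>M\<^esub> rstar \<alpha> m1 a \<otimes>\<^bsub>M\<^esub> m2)"


section \<open>Generators, basic pairs and compatible actions\<close>

text \<open>
  The four families of formal symbols: \<open>DotMN m n\<close>, \<open>DotNM n m\<close> are \<open>m \<odot> n\<close>, \<open>n \<odot> m\<close>, and
  \<open>StarMN m n\<close>, \<open>StarNM n m\<close> are their encircled-asterisk analogues.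
\<close>

datatype ('m, 'n) tgen = DotMN 'm 'n | DotNM 'n 'm | StarMN 'm 'n | StarNM 'n 'm

definition tgens :: "('k, 'm) awb \<Rightarrow> ('k, 'n) awb \<Rightarrow> ('m, 'n) tgen set"
  where "tgens M N = (\<Union>m\<in>carrier M. \<Union>n\<in>carrier N.
    {DotMN m n, DotNM n m, StarMN m n, StarNM n m})"

text \<open>Throughout, \<open>\<mu>\<close> is the action of \<open>M\<close> on \<open>N\<close> and \<open>\<nu>\<close> is the action of \<open>N\<close> on \<open>M\<close>.\<close>

primrec gen_pair ::
  "('m, 'n) awb_action \<Rightarrow> ('n, 'm) awb_action \<Rightarrow> ('m, 'n) tgen \<Rightarrow> 'm \<times> 'n"
  where
    "gen_pair \<mu> \<nu> (DotMN m n) = (rdot \<nu> m n, ldot \<mu> m n)"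
  | "gen_pair \<mu> \<nu> (DotNM n m) = (ldot \<nu> n m, rdot \<mu> n m)"
  | "gen_pair \<mu> \<nu> (StarMN m n) = (rstar \<nu> m n, lstar \<mu> m n)"
  | "gen_pair \<mu> \<nu> (StarNM n m) = (lstar \<nu> n m, rstar \<mu> n m)"

definition basic_pairs ::
  "('k, 'm) awb \<Rightarrow> ('k, 'n) awb \<Rightarrow> ('m, 'n) awb_action \<Rightarrow> ('n, 'm) awb_action \<Rightarrow> ('m \<times> 'n) set"
  where "basic_pairs M N \<mu> \<nu> = gen_pair \<mu> \<nu> ` tgens M N"

definition compatible_actions ::
  "('k, 'r) ring_scheme \<Rightarrow> ('k, 'm) awb \<Rightarrow> ('k, 'n) awb \<Rightarrow>
   ('m, 'n) awb_action \<Rightarrow> ('n, 'm) awb_action \<Rightarrow> bool"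
  where "compatible_actions K M N \<mu> \<nu> \<longleftrightarrow>
    acts_on K M N \<mu> \<and> acts_on K N M \<nu> \<and>
    (\<forall>(u\<^sub>M, u\<^sub>N) \<in> basic_pairs M N \<mu> \<nu>. \<forall>m\<in>carrier M. \<forall>n\<in>carrier N.
       rdot \<nu> m u\<^sub>N = m \<otimes>\<^bsub>M\<^esub> u\<^sub>M \<and> rstar \<nu> m u\<^sub>N = \<lbrace>m, u\<^sub>M\<rbrace>\<^bsub>M\<^esub> \<and>
       ldot \<mu> u\<^sub>M n = u\<^sub>N \<otimes>\<^bsub>N\<^esub> n \<and> lstar \<mu> u\<^sub>M n = \<lbrace>u\<^sub>N, n\<rbrace>\<^bsub>N\<^esub> \<and>
       rdot \<mu> n u\<^sub>M = n \<otimes>\<^bsub>N\<^esub> u\<^sub>N \<and> rstar \<mu> n u\<^sub>M = \<lbrace>n, u\<^sub>N\<rbrace>\<^bsub>N\<^esub> \<and>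
       ldot \<nu> u\<^sub>N m = u\<^sub>M \<otimes>\<^bsub>M\<^esub> m \<and> lstar \<nu> u\<^sub>N m = \<lbrace>u\<^sub>M, m\<rbrace>\<^bsub>M\<^esub>)"

definition preserves_actions ::
  "('k, 'm) awb \<Rightarrow> ('k, 'n) awb \<Rightarrow> ('m, 'n) awb_action \<Rightarrow> ('n, 'm) awb_action \<Rightarrow>
   ('m2, 'n2) awb_action \<Rightarrow> ('n2, 'm2) awb_action \<Rightarrow> ('m \<Rightarrow> 'm2) \<Rightarrow> ('n \<Rightarrow> 'n2) \<Rightarrow> bool"
  where "preserves_actions M N \<mu> \<nu> \<mu>' \<nu>' \<phi> \<gamma> \<longleftrightarrow>
    (\<forall>m\<in>carrier M. \<forall>n\<in>carrier N.
       \<phi> (ldot \<nu> n m) = ldot \<nu>' (\<gamma> n) (\<phi> m) \<and> \<phi> (rdot \<nu> m n) = rdot \<nu>' (\<phi> m) (\<gamma> n) \<and>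
       \<phi> (lstar \<nu> n m) = lstar \<nu>' (\<gamma> n) (\<phi> m) \<and> \<phi> (rstar \<nu> m n) = rstar \<nu>' (\<phi> m) (\<gamma> n) \<and>
       \<gamma> (ldot \<mu> m n) = ldot \<mu>' (\<phi> m) (\<gamma> n) \<and> \<gamma> (rdot \<mu> n m) = rdot \<mu>' (\<gamma> n) (\<phi> m) \<and>
       \<gamma> (lstar \<mu> m n) = lstar \<mu>' (\<phi> m) (\<gamma> n) \<and> \<gamma> (rstar \<mu> n m) = rstar \<mu>' (\<gamma> n) (\<phi> m))"


section \<open>Free vector spaces\<close>

text \<open>
  The vector space over \<open>K\<close> with basis \<open>S\<close>: finitely supported coefficient functions.  Its fields
  \<open>mult\<close> and \<open>one\<close> are placeholders.
\<close>

definition free_vs :: "('k, 'r) ring_scheme \<Rightarrow> 's set \<Rightarrow> ('k, 's \<Rightarrow> 'k) module"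
  where "free_vs K S = \<lparr>
    carrier = {c. (\<forall>s\<in>S. c s \<in> carrier K) \<and> (\<forall>s. s \<notin> S \<longrightarrow> c s = \<zero>\<^bsub>K\<^esub>) \<and>
                  finite {s. c s \<noteq> \<zero>\<^bsub>K\<^esub>}},
    mult = (\<lambda>c d s. \<zero>\<^bsub>K\<^esub>), one = (\<lambda>s. \<zero>\<^bsub>K\<^esub>),
    zero = (\<lambda>s. \<zero>\<^bsub>K\<^esub>), add = (\<lambda>c d s. c s \<oplus>\<^bsub>K\<^esub> d s),
    smult = (\<lambda>k c s. k \<otimes>\<^bsub>K\<^esub> c s)\<rparr>"

definition free_gen :: "('k, 'r) ring_scheme \<Rightarrow> 's \<Rightarrow> 's \<Rightarrow> 'k"
  where "free_gen K s = (\<lambda>t. if t = s then \<one>\<^bsub>K\<^esub> else \<zero>\<^bsub>K\<^esub>)"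

text \<open>The linear extension to the free vector space of a map \<open>\<phi>\<close> from the basis to \<open>V\<close>.\<close>

definition lin_ext ::
  "('k, 'r) ring_scheme \<Rightarrow> ('k, 'v, 'x) module_scheme \<Rightarrow> ('s \<Rightarrow> 'v) \<Rightarrow> ('s \<Rightarrow> 'k) \<Rightarrow> 'v"
  where "lin_ext K V \<phi> c = (\<Oplus>\<^bsub>V\<^esub> s \<in> {s. c s \<noteq> \<zero>\<^bsub>K\<^esub>}. c s \<odot>\<^bsub>V\<^esub> \<phi> s)"


section \<open>The non-abelian tensor product\<close>

text \<open>
  The free vector space on the symbols, with the bilinear operations determined by
  \<open>g h = g\<^sub>M \<odot> h\<^sub>N\<close> and by its bracket analogue on generators.  This is not yet an algebra with
  bracket; only its quotient below is.
\<close>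

definition pre_tensor ::
  "('k, 'r) ring_scheme \<Rightarrow> ('k, 'm) awb \<Rightarrow> ('k, 'n) awb \<Rightarrow>
   ('m, 'n) awb_action \<Rightarrow> ('n, 'm) awb_action \<Rightarrow> ('k, ('m, 'n) tgen \<Rightarrow> 'k) awb"
  where "pre_tensor K M N \<mu> \<nu> = (let F = free_vs K (tgens M N) in \<lparr>
    carrier = carrier F,
    mult = (\<lambda>c d. lin_ext K F (\<lambda>g. lin_ext K F
       (\<lambda>h. free_gen K (DotMN (fst (gen_pair \<mu> \<nu> g)) (snd (gen_pair \<mu> \<nu> h)))) d) c),
    one = one F, zero = zero F, add = add F, smult = smult F,
    bracket = (\<lambda>c d. lin_ext K F (\<lambda>g. lin_ext K F
       (\<lambda>h. free_gen K (StarMN (fst (gen_pair \<mu> \<nu> g)) (snd (gen_pair \<mu> \<nu> h)))) d) c)\<rparr>)"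

text \<open>
  A relation \<open>x = y\<close> is recorded as the element \<open>x - y\<close> of the free vector space \<open>F\<close>.

  The relations that are to be imposed twice, the second time with \<open>M\<close> and \<open>N\<close> exchanged, are
  parametrised by the four families of symbols: \<open>d m n\<close>, \<open>d' n m\<close> stand for \<open>m \<odot> n\<close>, \<open>n \<odot> m\<close>, and
  \<open>s m n\<close>, \<open>s' n m\<close> for their encircled-asterisk analogues.
\<close>

definition bilinearity_rels ::
  "('k, 'r) ring_scheme \<Rightarrow> ('k, 'f) awb \<Rightarrow> ('k, 'm) awb \<Rightarrow> ('k, 'n) awb \<Rightarrow>
   ('m \<Rightarrow> 'n \<Rightarrow> 'f) \<Rightarrow> 'f set"
  where "bilinearity_rels K F M N d =
    (\<Union>k\<in>carrier K. \<Union>m\<in>carrier M. \<Union>n\<in>carrier N.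
       {k \<odot>\<^bsub>F\<^esub> d m n \<ominus>\<^bsub>F\<^esub> d (k \<odot>\<^bsub>M\<^esub> m) n, k \<odot>\<^bsub>F\<^esub> d m n \<ominus>\<^bsub>F\<^esub> d m (k \<odot>\<^bsub>N\<^esub> n)}) \<union>
    (\<Union>m\<in>carrier M. \<Union>m'\<in>carrier M. \<Union>n\<in>carrier N.
       {d (m \<oplus>\<^bsub>M\<^esub> m') n \<ominus>\<^bsub>F\<^esub> (d m n \<oplus>\<^bsub>F\<^esub> d m' n)}) \<union>
    (\<Union>m\<in>carrier M. \<Union>n\<in>carrier N. \<Union>n'\<in>carrier N.
       {d m (n \<oplus>\<^bsub>N\<^esub> n') \<ominus>\<^bsub>F\<^esub> (d m n \<oplus>\<^bsub>F\<^esub> d m n')})"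

definition action_rels ::
  "('k, 'f) awb \<Rightarrow> ('k, 'm) awb \<Rightarrow> ('k, 'n) awb \<Rightarrow> ('m, 'n) awb_action \<Rightarrow>
   ('m \<Rightarrow> 'n \<Rightarrow> 'f) \<Rightarrow> ('n \<Rightarrow> 'm \<Rightarrow> 'f) \<Rightarrow> ('m \<Rightarrow> 'n \<Rightarrow> 'f) \<Rightarrow> ('n \<Rightarrow> 'm \<Rightarrow> 'f) \<Rightarrow> 'f set"
  where "action_rels F M N \<mu> d d' s s' =
    (\<Union>m1\<in>carrier M. \<Union>m2\<in>carrier M. \<Union>n\<in>carrier N.
      {d (m1 \<otimes>\<^bsub>M\<^esub> m2) n \<ominus>\<^bsub>F\<^esub> d m1 (ldot \<mu> m2 n),
       d' n (m1 \<otimes>\<^bsub>M\<^esub> m2) \<ominus>\<^bsub>F\<^esub> d' (rdot \<mu> n m1) m2,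
       s (m1 \<otimes>\<^bsub>M\<^esub> m2) n \<ominus>\<^bsub>F\<^esub> (d m1 (lstar \<mu> m2 n) \<oplus>\<^bsub>F\<^esub> d' (lstar \<mu> m1 n) m2),
       s' (ldot \<mu> m1 n) m2 \<ominus>\<^bsub>F\<^esub> (d m1 (rstar \<mu> n m2) \<oplus>\<^bsub>F\<^esub> d \<lbrace>m1, m2\<rbrace>\<^bsub>M\<^esub> n),
       s' (rdot \<mu> n m1) m2 \<ominus>\<^bsub>F\<^esub> (d' (rstar \<mu> n m2) m1 \<oplus>\<^bsub>F\<^esub> d' n \<lbrace>m1, m2\<rbrace>\<^bsub>M\<^esub>),
       d' (ldot \<mu> m1 n) m2 \<ominus>\<^bsub>F\<^esub> d m1 (rdot \<mu> n m2)})"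

definition tensor_rels ::
  "('k, 'r) ring_scheme \<Rightarrow> ('k, 'm) awb \<Rightarrow> ('k, 'n) awb \<Rightarrow>
   ('m, 'n) awb_action \<Rightarrow> ('n, 'm) awb_action \<Rightarrow> (('m, 'n) tgen \<Rightarrow> 'k) set"
  where "tensor_rels K M N \<mu> \<nu> =
    (let F = pre_tensor K M N \<mu> \<nu>;
         d = (\<lambda>m n. free_gen K (DotMN m n)); d' = (\<lambda>n m. free_gen K (DotNM n m));
         s = (\<lambda>m n. free_gen K (StarMN m n)); s' = (\<lambda>n m. free_gen K (StarNM n m))
     in bilinearity_rels K F M N d \<union> bilinearity_rels K F M N s \<union>
        bilinearity_rels K F N M d' \<union> bilinearity_rels K F N M s' \<union>
        (\<Union>(u\<^sub>M, u\<^sub>N) \<in> basic_pairs M N \<mu> \<nu>. \<Union>(v\<^sub>M, v\<^sub>N) \<in> basic_pairs M N \<mu> \<nu>.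
           {d u\<^sub>M v\<^sub>N \<ominus>\<^bsub>F\<^esub> d' u\<^sub>N v\<^sub>M, s u\<^sub>M v\<^sub>N \<ominus>\<^bsub>F\<^esub> s' u\<^sub>N v\<^sub>M}) \<union>
        action_rels F M N \<mu> d d' s s' \<union> action_rels F N M \<nu> d' d s' s)"

definition tensor_ker ::
  "('k, 'r) ring_scheme \<Rightarrow> ('k, 'm) awb \<Rightarrow> ('k, 'n) awb \<Rightarrow>
   ('m, 'n) awb_action \<Rightarrow> ('n, 'm) awb_action \<Rightarrow> (('m, 'n) tgen \<Rightarrow> 'k) set"
  where "tensor_ker K M N \<mu> \<nu> =
    (\<lambda>H. submodule H K (pre_tensor K M N \<mu> \<nu>)) hull tensor_rels K M N \<mu> \<nu>"

text \<open>
  As in \<^const>\<open>FactRing\<close>, an operation on cosets is given by the union over all representatives, so it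
  yields a coset precisely when it is independent of the representatives.
\<close>

definition tensor ::
  "('k, 'r) ring_scheme \<Rightarrow> ('k, 'm) awb \<Rightarrow> ('k, 'n) awb \<Rightarrow>
   ('m, 'n) awb_action \<Rightarrow> ('n, 'm) awb_action \<Rightarrow> ('k, (('m, 'n) tgen \<Rightarrow> 'k) set) awb"
  where "tensor K M N \<mu> \<nu> =
    (let F = pre_tensor K M N \<mu> \<nu>; R = tensor_ker K M N \<mu> \<nu> in \<lparr>
      carrier = a_rcosets\<^bsub>F\<^esub> R,
      mult = rcoset_mult F R,
      one = R +>\<^bsub>F\<^esub> \<one>\<^bsub>F\<^esub>, zero = R, add = set_add F,
      smult = (\<lambda>k X. \<Union>x\<in>X. R +>\<^bsub>F\<^esub> (k \<odot>\<^bsub>F\<^esub> x)),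
      bracket = (\<lambda>X Y. \<Union>x\<in>X. \<Union>y\<in>Y. R +>\<^bsub>F\<^esub> \<lbrace>x, y\<rbrace>\<^bsub>F\<^esub>)\<rparr>)"

text \<open>
  The map induced by \<open>\<phi>\<close> and \<open>\<gamma>\<close> on cosets; only the data \<open>M'\<close>, \<open>N'\<close>, \<open>\<mu>'\<close>, \<open>\<nu>'\<close> of the codomain enter
  its definition.  On symbols, \<^const>\<open>map_tgen\<close> applies \<open>\<phi>\<close> and \<open>\<gamma>\<close> to the two entries.
\<close>

definition tensor_map ::
  "('k, 'r) ring_scheme \<Rightarrow> ('k, 'm2) awb \<Rightarrow> ('k, 'n2) awb \<Rightarrow>
   ('m2, 'n2) awb_action \<Rightarrow> ('n2, 'm2) awb_action \<Rightarrow> ('m \<Rightarrow> 'm2) \<Rightarrow> ('n \<Rightarrow> 'n2) \<Rightarrow>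
   (('m, 'n) tgen \<Rightarrow> 'k) set \<Rightarrow> (('m2, 'n2) tgen \<Rightarrow> 'k) set"
  where "tensor_map K M' N' \<mu>' \<nu>' \<phi> \<gamma> X =
    (let F' = pre_tensor K M' N' \<mu>' \<nu>'
     in \<Union>x\<in>X. tensor_ker K M' N' \<mu>' \<nu>' +>\<^bsub>F'\<^esub>
          lin_ext K F' (\<lambda>g. free_gen K (map_tgen \<phi> \<gamma> g)) x)"

end

theory Submission
  imports Defs
begin

text \<open>
  Write \<open>T\<^sub>i\<close> for the tensor product of \<open>M\<^sub>i\<close> and \<open>N\<close>, written as \<open>F\<^sub>i\<close> modulo \<open>R\<^sub>i\<close>, where \<open>F\<^sub>i\<close> is the
  free vector space on the symbols and \<open>R\<^sub>i\<close> the subspace spanned by the relations.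
  
  The tensor product is an algebra with bracket because its operations are controlled by two linear maps.
  Extending the basic pairs of the symbols linearly gives maps \<open>prM\<close> and \<open>prN\<close> from \<open>F\<close> to \<open>M\<close> and \<open>N\<close>,
  and the axioms of actions together with compatibility imply that both kill every relation
  (\<open>rels_killed\<close>).  Modulo \<open>R\<close> the product of \<open>x\<close> and \<open>y\<close> is the dot symbol of \<open>prM x\<close> and \<open>prN y\<close>, and the
  bracket is the corresponding star symbol (\<open>T_mult\<close>).  Hence the operations are well defined and bilinear
  on cosets, and the two axioms of an algebra with bracket become the two relations that resolve
  \<open>(m\<^sub>1 m\<^sub>2) \<odot> n\<close> and its bracket analogue (\<open>awb_T\<close>).
  
  A pair of homomorphisms that preserves the actions maps symbols to symbols and relations to relations
  of the same shape.  So it induces a linear map \<open>push\<close> of free vector spaces that maps \<open>R\<close> into \<open>R'\<close>, and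
  thereby a homomorphism of tensor products.  If both homomorphisms are surjective, each element that
  occurs in a relation of the codomain can be lifted, so every relation of the codomain is the image of a
  relation, and \<open>R' = push(R)\<close> (\<open>push_R_surj\<close>); the induced map is then surjective as well.
  
  For exactness in the middle let \<open>x\<close> in \<open>F\<^sub>2\<close> have an image under \<open>g\<close> in \<open>R\<^sub>3\<close>.  Since \<open>R\<^sub>3\<close> is the image of
  \<open>R\<^sub>2\<close>, subtracting an element of \<open>R\<^sub>2\<close> leaves some \<open>y\<close> whose image in \<open>F\<^sub>3\<close> is zero.  Choose a set-theoretic
  section \<open>\<sigma>\<close> of \<open>g\<close>.  For every symbol the difference between \<open>m \<odot> n\<close> and \<open>\<sigma>(g m) \<odot> n\<close> is, in \<open>T\<^sub>2\<close>, equal to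
  \<open>(m - \<sigma>(g m)) \<odot> n\<close>, and \<open>m - \<sigma>(g m)\<close> is in the kernel of \<open>g\<close>, hence in the image of \<open>f\<close>.  By linearity every
  \<open>y\<close> differs from the lift of its image in \<open>F\<^sub>3\<close> by something coming from \<open>T\<^sub>1\<close>; that lift is zero here
  (\<open>tensor_kernel_subset_image\<close>).
\<close>

section \<open>Linear maps\<close>

definition linear_on ::
  "('k, 'r) ring_scheme \<Rightarrow> ('k, 'u, 'x) module_scheme \<Rightarrow> ('k, 'v, 'y) module_scheme \<Rightarrow> ('u \<Rightarrow> 'v) \<Rightarrow> bool"
  where "linear_on K U V h \<longleftrightarrow> h \<in> carrier U \<rightarrow> carrier V \<and>
    (\<forall>x\<in>carrier U. \<forall>y\<in>carrier U. h (x \<oplus>\<^bsub>U\<^esub> y) = h x \<oplus>\<^bsub>V\<^esub> h y) \<and>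
    (\<forall>k\<in>carrier K. \<forall>x\<in>carrier U. h (k \<odot>\<^bsub>U\<^esub> x) = k \<odot>\<^bsub>V\<^esub> h x)"

lemma linear_onI:
  assumes "\<And>x. x \<in> carrier U \<Longrightarrow> h x \<in> carrier V"
    and "\<And>x y. \<lbrakk>x \<in> carrier U; y \<in> carrier U\<rbrakk> \<Longrightarrow> h (x \<oplus>\<^bsub>U\<^esub> y) = h x \<oplus>\<^bsub>V\<^esub> h y"
    and "\<And>k x. \<lbrakk>k \<in> carrier K; x \<in> carrier U\<rbrakk> \<Longrightarrow> h (k \<odot>\<^bsub>U\<^esub> x) = k \<odot>\<^bsub>V\<^esub> h x"
  shows "linear_on K U V h"
  using assms by (auto simp: linear_on_def)

lemma linear_on_closed: "linear_on K U V h \<Longrightarrow> x \<in> carrier U \<Longrightarrow> h x \<in> carrier V"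
  and linear_on_add:
    "linear_on K U V h \<Longrightarrow> x \<in> carrier U \<Longrightarrow> y \<in> carrier U \<Longrightarrow> h (x \<oplus>\<^bsub>U\<^esub> y) = h x \<oplus>\<^bsub>V\<^esub> h y"
  and linear_on_smult:
    "linear_on K U V h \<Longrightarrow> k \<in> carrier K \<Longrightarrow> x \<in> carrier U \<Longrightarrow> h (k \<odot>\<^bsub>U\<^esub> x) = k \<odot>\<^bsub>V\<^esub> h x"
  by (auto simp: linear_on_def)

lemma linear_on_zero:
  assumes "module K U" "module K V" "linear_on K U V h"
  shows "h \<zero>\<^bsub>U\<^esub> = \<zero>\<^bsub>V\<^esub>"
proof -
  interpret U: module K U by fact
  interpret V: module K V by fact
  have "h (\<zero>\<^bsub>K\<^esub> \<odot>\<^bsub>U\<^esub> \<zero>\<^bsub>U\<^esub>) = \<zero>\<^bsub>K\<^esub> \<odot>\<^bsub>V\<^esub> h \<zero>\<^bsub>U\<^esub>"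
    using linear_on_smult[OF assms(3)] by blast
  then show ?thesis using linear_on_closed[OF assms(3)] by simp
qed

lemma linear_on_uminus:
  assumes "module K U" "module K V" "linear_on K U V h" "x \<in> carrier U"
  shows "h (\<ominus>\<^bsub>U\<^esub> x) = \<ominus>\<^bsub>V\<^esub> h x"
proof -
  interpret U: module K U by fact
  interpret V: module K V by fact
  have "h (\<ominus>\<^bsub>U\<^esub> x) \<oplus>\<^bsub>V\<^esub> h x = \<zero>\<^bsub>V\<^esub>"
    using linear_on_add[OF assms(3), of "\<ominus>\<^bsub>U\<^esub> x" x] assms(4) linear_on_zero[OF assms(1-3)]
    by (simp add: U.l_neg)
  then show ?thesis using linear_on_closed[OF assms(3)] assms(4)
    by (metis U.add.inv_closed V.minus_equality)
qed

lemma linear_on_minus: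
  assumes "module K U" "module K V" "linear_on K U V h" "x \<in> carrier U" "y \<in> carrier U"
  shows "h (x \<ominus>\<^bsub>U\<^esub> y) = h x \<ominus>\<^bsub>V\<^esub> h y"
proof -
  interpret U: module K U by fact
  show ?thesis using assms(4,5)
    by (simp add: a_minus_def linear_on_add[OF assms(3)] linear_on_uminus[OF assms(1-3)])
qed

lemma minus_zero_imp_eq:
  fixes G (structure)
  assumes "abelian_group G" "x \<ominus> y = \<zero>" "x \<in> carrier G" "y \<in> carrier G"
  shows "x = y"
proof -
  interpret abelian_group G by fact
  show ?thesis using assms(2-4) minus_equality[of x "\<ominus> y"] by (simp add: a_minus_def)
qed

lemma linear_on_diff:
  assumes "module K V" "linear_on K U V h" "linear_on K U V h'"
  shows "linear_on K U V (\<lambda>x. h x \<ominus>\<^bsub>V\<^esub> h' x)"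
proof -
  interpret V: module K V by fact
  note c = linear_on_closed[OF assms(2)] linear_on_closed[OF assms(3)]
  show ?thesis
    by (rule linear_onI)
      (simp_all add: c linear_on_add[OF assms(2)] linear_on_add[OF assms(3)]
        linear_on_smult[OF assms(2)] linear_on_smult[OF assms(3)]
        V.minus_eq V.minus_add V.a_ac V.smult_r_distr V.smult_r_minus)
qed

lemma linear_on_comp:
  "linear_on K U V h \<Longrightarrow> linear_on K V W h' \<Longrightarrow> linear_on K U W (\<lambda>x. h' (h x))"
  by (auto simp: linear_on_def Pi_iff)

lemma linear_on_vimage:
  assumes "module K U" "module K V" "linear_on K U V h" "submodule H K V"
  shows "submodule {x \<in> carrier U. h x \<in> H} K U"
proof -
  interpret U: module K U by fact
  interpret V: module K V by fact
  note H = V.submoduleE[OF assms(4)]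
  have "\<zero>\<^bsub>V\<^esub> \<in> H" using subgroup.one_closed[OF submodule.axioms(1)[OF assms(4)]] by simp
  then show ?thesis
    by (intro U.submoduleI)
      (auto simp: linear_on_zero[OF assms(1-3)] linear_on_uminus[OF assms(1-3)]
        linear_on_add[OF assms(3)] linear_on_smult[OF assms(3)] H)
qed

lemma linear_on_image:
  assumes "module K U" "module K V" "linear_on K U V h" "submodule H K U"
  shows "submodule (h ` H) K V"
proof -
  interpret U: module K U by fact
  interpret V: module K V by fact
  note H = U.submoduleE[OF assms(4)]
  have H0: "\<zero>\<^bsub>U\<^esub> \<in> H" using subgroup.one_closed[OF submodule.axioms(1)[OF assms(4)]] by simp
  show ?thesis
  proof (rule V.submoduleI)
    show "h ` H \<subseteq> carrier V" using H(1) linear_on_closed[OF assms(3)] by blast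
    show "\<zero>\<^bsub>V\<^esub> \<in> h ` H" using H0 linear_on_zero[OF assms(1-3)] by (metis imageI)
    show "\<ominus>\<^bsub>V\<^esub> a \<in> h ` H" if "a \<in> h ` H" for a
      using that H(1,3) linear_on_uminus[OF assms(1-3)] by (force simp: image_iff)
    show "a \<oplus>\<^bsub>V\<^esub> b \<in> h ` H" if ab: "a \<in> h ` H" "b \<in> h ` H" for a b
    proof -
      obtain x y where "x \<in> H" "y \<in> H" "a = h x" "b = h y" using ab by blast
      then show ?thesis using H(1) H(5)[of x y] linear_on_add[OF assms(3), of x y]
        by (metis imageI subsetD)
    qed
    show "k \<odot>\<^bsub>V\<^esub> x \<in> h ` H" if "k \<in> carrier K" "x \<in> h ` H" for k x
      using that H(1,4) linear_on_smult[OF assms(3)] by (force simp: image_iff)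
  qed
qed

lemma zero_submodule:
  assumes "module K V"
  shows "submodule {\<zero>\<^bsub>V\<^esub>} K V"
proof -
  interpret V: module K V by fact
  show ?thesis by (rule V.submoduleI) auto
qed

lemma bilinear_on_iff_linear:
  "bilinear_on K U V W b \<longleftrightarrow>
    (\<forall>v\<in>carrier V. linear_on K U W (\<lambda>u. b u v)) \<and> (\<forall>u\<in>carrier U. linear_on K V W (b u))"
  unfolding bilinear_on_def linear_on_def Pi_iff by blast

lemma bilinear_on_left: "bilinear_on K U V W b \<Longrightarrow> v \<in> carrier V \<Longrightarrow> linear_on K U W (\<lambda>u. b u v)"
  and bilinear_on_right: "bilinear_on K U V W b \<Longrightarrow> u \<in> carrier U \<Longrightarrow> linear_on K V W (b u)"
  by (simp_all add: bilinear_on_iff_linear)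

lemma (in module) bilinear_on_minus_left:
  assumes b: "bilinear_on R U V M b" and U: "module R U"
    and u: "u \<in> carrier U" "u' \<in> carrier U" and v: "v \<in> carrier V"
  shows "b u v \<ominus>\<^bsub>M\<^esub> b u' v = b (u \<ominus>\<^bsub>U\<^esub> u') v"
  using linear_on_minus[OF U module_axioms bilinear_on_left[OF b v] u] by simp

lemma (in module) bilinear_on_minus_right:
  assumes b: "bilinear_on R U V M b" and V: "module R V"
    and u: "u \<in> carrier U" and v: "v \<in> carrier V" "v' \<in> carrier V"
  shows "b u v \<ominus>\<^bsub>M\<^esub> b u v' = b u (v \<ominus>\<^bsub>V\<^esub> v')"
  using linear_on_minus[OF V module_axioms bilinear_on_right[OF b u] v] by simp

lemma bilinear_on_closed:
  "bilinear_on K U V W b \<Longrightarrow> u \<in> carrier U \<Longrightarrow> v \<in> carrier V \<Longrightarrow> b u v \<in> carrier W"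
  by (simp add: bilinear_on_def)

lemma submodule_hull:
  assumes "module K V" "S \<subseteq> carrier V"
  shows "submodule ((\<lambda>H. submodule H K V) hull S) K V"
proof -
  interpret V: module K V by fact
  let ?C = "{H. submodule H K V \<and> S \<subseteq> H}"
  have car: "carrier V \<in> ?C" using assms(2) V.carrier_is_submodule by blast
  have z: "\<zero>\<^bsub>V\<^esub> \<in> H" if "submodule H K V" for H
    using subgroup.one_closed[OF submodule.axioms(1)[OF that]] by simp
  have "submodule (\<Inter>?C) K V"
  proof (rule V.submoduleI)
    show "\<Inter>?C \<subseteq> carrier V" using car by blast
  qed (use z V.submoduleE in auto)
  then show ?thesis by (simp add: hull_def)
qed

text \<open>
  The free vector space carries placeholder multiplications, and the pre-tensor is a record of another
  type with the same underlying space.  Linear facts have to be carried across, and the next lemmas do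
  this for records that agree in carrier, zero, addition and scalar multiplication.
\<close>

lemma module_cong:
  fixes U :: "('k, 'f, 'x) module_scheme" and V :: "('k, 'f, 'y) module_scheme"
  assumes U: "module K U" and eq: "carrier V = carrier U" "zero V = zero U" "add V = add U" "smult V = smult U"
  shows "module K V"
proof -
  interpret U: module K U by fact
  show ?thesis
  proof (rule moduleI)
    show "abelian_group V"
    proof (rule abelian_groupI)
      show "\<exists>y\<in>carrier V. y \<oplus>\<^bsub>V\<^esub> x = \<zero>\<^bsub>V\<^esub>" if "x \<in> carrier V" for x
        using that U.l_neg U.a_inv_closed unfolding eq by blast
    qed (auto simp: eq U.a_ac)
  qed (auto simp: eq U.is_cring U.smult_l_distr U.smult_r_distr U.smult_assoc1)
qed

lemma a_inv_module_cong:
  fixes U :: "('k, 'f, 'x) module_scheme" and V :: "('k, 'f, 'y) module_scheme"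
  assumes U: "module K U" and eq: "carrier V = carrier U" "zero V = zero U" "add V = add U" "smult V = smult U"
    and x: "x \<in> carrier U"
  shows "\<ominus>\<^bsub>V\<^esub> x = \<ominus>\<^bsub>U\<^esub> x"
proof -
  interpret U: module K U by fact
  interpret V: module K V by (rule module_cong) fact+
  show ?thesis using x V.minus_equality[of "\<ominus>\<^bsub>U\<^esub> x" x] by (simp add: eq U.l_neg)
qed

lemma submodule_cong:
  fixes U :: "('k, 'f, 'x) module_scheme" and V :: "('k, 'f, 'y) module_scheme"
  assumes U: "module K U" and eq: "carrier V = carrier U" "zero V = zero U" "add V = add U" "smult V = smult U"
    and H: "submodule H K U"
  shows "submodule H K V"
proof -
  interpret U: module K U by fact
  interpret V: module K V by (rule module_cong) fact+
  note Hs = U.submoduleE[OF H]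
  have "\<zero>\<^bsub>U\<^esub> \<in> H" using subgroup.one_closed[OF submodule.axioms(1)[OF H]] by simp
  then show ?thesis using Hs a_inv_module_cong[OF U eq]
    by (intro V.submoduleI) (auto simp: eq subset_iff)
qed

section \<open>Free vector spaces\<close>

lemma free_vs_simps [simp]:
  "zero (free_vs K S) = (\<lambda>s. \<zero>\<^bsub>K\<^esub>)"
  "add (free_vs K S) = (\<lambda>c d s. c s \<oplus>\<^bsub>K\<^esub> d s)"
  "smult (free_vs K S) = (\<lambda>k c s. k \<otimes>\<^bsub>K\<^esub> c s)"
  by (simp_all add: free_vs_def)

lemma free_vs_carrier:
  "c \<in> carrier (free_vs K S) \<longleftrightarrow>
    (\<forall>s\<in>S. c s \<in> carrier K) \<and> (\<forall>s. s \<notin> S \<longrightarrow> c s = \<zero>\<^bsub>K\<^esub>) \<and> finite {s. c s \<noteq> \<zero>\<^bsub>K\<^esub>}"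
  by (simp add: free_vs_def)

lemma (in cring) free_vs_coeff: "c \<in> carrier (free_vs R S) \<Longrightarrow> c s \<in> carrier R"
  by (cases "s \<in> S") (auto simp: free_vs_carrier)

lemma (in cring) free_vs_module: "module R (free_vs R S)"
proof (rule moduleI)
  show "cring R" by (rule is_cring)
  show "abelian_group (free_vs R S)"
  proof (rule abelian_groupI)
    fix c d assume "c \<in> carrier (free_vs R S)" "d \<in> carrier (free_vs R S)"
    moreover have "{s. c s \<oplus> d s \<noteq> \<zero>} \<subseteq> {s. c s \<noteq> \<zero>} \<union> {s. d s \<noteq> \<zero>}" by auto
    ultimately show "c \<oplus>\<^bsub>free_vs R S\<^esub> d \<in> carrier (free_vs R S)"
      by (auto simp: free_vs_carrier elim: finite_subset)
  next
    fix c assume c: "c \<in> carrier (free_vs R S)"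
    have "{s. \<ominus> c s \<noteq> \<zero>} \<subseteq> {s. c s \<noteq> \<zero>}" by auto
    then have "(\<lambda>s. \<ominus> c s) \<in> carrier (free_vs R S)"
      using c by (auto simp: free_vs_carrier elim: finite_subset)
    then show "\<exists>d\<in>carrier (free_vs R S). d \<oplus>\<^bsub>free_vs R S\<^esub> c = \<zero>\<^bsub>free_vs R S\<^esub>"
      using free_vs_coeff[OF c] by (intro bexI[of _ "\<lambda>s. \<ominus> c s"]) (auto simp: l_neg)
  qed (auto simp: free_vs_coeff fun_eq_iff a_ac free_vs_carrier[of "\<lambda>s. \<zero>"])
next
  fix k c assume "k \<in> carrier R" "c \<in> carrier (free_vs R S)"
  moreover from this(1) have "{s. k \<otimes> c s \<noteq> \<zero>} \<subseteq> {s. c s \<noteq> \<zero>}" by auto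
  ultimately show "k \<odot>\<^bsub>free_vs R S\<^esub> c \<in> carrier (free_vs R S)"
    by (auto simp: free_vs_carrier elim: finite_subset)
qed (auto simp: fun_eq_iff free_vs_coeff l_distr r_distr m_assoc)

lemma (in cring) free_gen_closed: "s \<in> S \<Longrightarrow> free_gen R s \<in> carrier (free_vs R S)"
  by (auto simp: free_vs_carrier free_gen_def elim: finite_subset[rotated])

text \<open>
  Induction on the support: splitting off one basis vector with its coefficient leaves a vector of
  strictly smaller support.
\<close>

lemma (in cring) free_vs_subset_submodule:
  assumes H: "submodule H R (free_vs R S)" and gen: "\<And>s. s \<in> S \<Longrightarrow> free_gen R s \<in> H"
  shows "carrier (free_vs R S) \<subseteq> H"
proof
  interpret V: module R "free_vs R S" by (rule free_vs_module)
  note Hs = V.submoduleE[OF H]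
  fix c assume c: "c \<in> carrier (free_vs R S)"
  then have "finite {s. c s \<noteq> \<zero>}" by (simp add: free_vs_carrier)
  from this c show "c \<in> H"
  proof (induction "{s. c s \<noteq> \<zero>}" arbitrary: c rule: finite_psubset_induct)
    case (psubset c)
    show ?case
    proof (cases "\<exists>s. c s \<noteq> \<zero>")
      case False
      then have "c = \<zero>\<^bsub>free_vs R S\<^esub>" by (auto simp: fun_eq_iff)
      then show ?thesis using subgroup.one_closed[OF submodule.axioms(1)[OF H]] by simp
    next
      case True
      then obtain s where s: "c s \<noteq> \<zero>" by blast
      then have sS: "s \<in> S" using psubset.prems by (auto simp: free_vs_carrier)
      let ?c = "c(s := \<zero>)"
      have sub: "{t. ?c t \<noteq> \<zero>} \<subset> {t. c t \<noteq> \<zero>}" using s by auto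
      have "finite {t. ?c t \<noteq> \<zero>}" by (rule finite_subset[OF _ psubset.hyps(1)]) (use sub in blast)
      then have "?c \<in> carrier (free_vs R S)"
        using psubset.prems by (auto simp: free_vs_carrier)
      then have "?c \<in> H" using psubset.hyps sub by blast
      moreover have "c s \<odot>\<^bsub>free_vs R S\<^esub> free_gen R s \<in> H"
        using gen[OF sS] Hs(4) free_vs_coeff[OF psubset.prems] by blast
      moreover have "c = c s \<odot>\<^bsub>free_vs R S\<^esub> free_gen R s \<oplus>\<^bsub>free_vs R S\<^esub> ?c"
        using free_vs_coeff[OF psubset.prems] by (auto simp: fun_eq_iff free_gen_def)
      ultimately show ?thesis using Hs(5) by metis
    qed
  qed
qed

text \<open>
  Summing over any finite set that contains the support makes the sums for different arguments
  comparable, which is what linearity of the extension needs.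
\<close>

lemma (in cring) lin_ext_superset:
  assumes V: "module R V" and \<phi>: "\<And>s. s \<in> S \<Longrightarrow> \<phi> s \<in> carrier V"
    and c: "c \<in> carrier (free_vs R S)" and A: "finite A" "{s. c s \<noteq> \<zero>} \<subseteq> A" "A \<subseteq> S"
  shows "lin_ext R V \<phi> c = (\<Oplus>\<^bsub>V\<^esub> s \<in> A. c s \<odot>\<^bsub>V\<^esub> \<phi> s)"
proof -
  interpret V: module R V by fact
  show ?thesis unfolding lin_ext_def
  proof (rule V.add.finprod_mono_neutral_cong_left)
    show "c i \<odot>\<^bsub>V\<^esub> \<phi> i = \<zero>\<^bsub>V\<^esub>" if "i \<in> A - {s. c s \<noteq> \<zero>}" for i
      using that A \<phi> by auto
    show "(\<lambda>s. c s \<odot>\<^bsub>V\<^esub> \<phi> s) \<in> A \<rightarrow> carrier V"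
      using A \<phi> free_vs_coeff[OF c] by auto
  qed (use A in auto)
qed

lemma (in cring) lin_ext_linear:
  assumes V: "module R V" and \<phi>: "\<And>s. s \<in> S \<Longrightarrow> \<phi> s \<in> carrier V"
  shows "linear_on R (free_vs R S) V (lin_ext R V \<phi>)"
proof -
  interpret V: module R V by fact
  interpret F: module R "free_vs R S" by (rule free_vs_module)
  have supp: "finite {s. c s \<noteq> \<zero>}" "{s. c s \<noteq> \<zero>} \<subseteq> S" if "c \<in> carrier (free_vs R S)" for c
    using that by (auto simp: free_vs_carrier)
  have term_closed: "c s \<odot>\<^bsub>V\<^esub> \<phi> s \<in> carrier V" if "c \<in> carrier (free_vs R S)" "s \<in> S" for c s
    using \<phi>[OF that(2)] free_vs_coeff[OF that(1)] by (rule V.smult_closed[rotated])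
  show ?thesis
  proof (rule linear_onI)
    fix c assume c: "c \<in> carrier (free_vs R S)"
    show "lin_ext R V \<phi> c \<in> carrier V"
      unfolding lin_ext_def by (rule V.finsum_closed) (use supp[OF c] term_closed[OF c] in auto)
    fix d assume d: "d \<in> carrier (free_vs R S)"
    let ?A = "{s. c s \<noteq> \<zero>} \<union> {s. d s \<noteq> \<zero>}"
    have A: "finite ?A" "?A \<subseteq> S" using supp[OF c] supp[OF d] by auto
    have sub: "{s. (c \<oplus>\<^bsub>free_vs R S\<^esub> d) s \<noteq> \<zero>} \<subseteq> ?A" by auto
    have "lin_ext R V \<phi> (c \<oplus>\<^bsub>free_vs R S\<^esub> d) = (\<Oplus>\<^bsub>V\<^esub> s \<in> ?A. (c \<oplus>\<^bsub>free_vs R S\<^esub> d) s \<odot>\<^bsub>V\<^esub> \<phi> s)"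
      using lin_ext_superset[OF V \<phi> F.add.m_closed[OF c d] A(1) sub A(2)] .
    also have "\<dots> = (\<Oplus>\<^bsub>V\<^esub> s \<in> ?A. c s \<odot>\<^bsub>V\<^esub> \<phi> s \<oplus>\<^bsub>V\<^esub> d s \<odot>\<^bsub>V\<^esub> \<phi> s)"
      by (rule V.finsum_cong')
        (use A term_closed[OF c] term_closed[OF d] \<phi> free_vs_coeff[OF c] free_vs_coeff[OF d]
          in \<open>auto simp: V.smult_l_distr subset_iff\<close>)
    also have "\<dots> = (\<Oplus>\<^bsub>V\<^esub> s \<in> ?A. c s \<odot>\<^bsub>V\<^esub> \<phi> s) \<oplus>\<^bsub>V\<^esub> (\<Oplus>\<^bsub>V\<^esub> s \<in> ?A. d s \<odot>\<^bsub>V\<^esub> \<phi> s)"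
      by (rule V.finsum_addf) (use A term_closed[OF c] term_closed[OF d] in auto)
    also have "\<dots> = lin_ext R V \<phi> c \<oplus>\<^bsub>V\<^esub> lin_ext R V \<phi> d"
      using lin_ext_superset[OF V \<phi> c A(1) _ A(2)] lin_ext_superset[OF V \<phi> d A(1) _ A(2)] by simp
    finally show "lin_ext R V \<phi> (c \<oplus>\<^bsub>free_vs R S\<^esub> d) = lin_ext R V \<phi> c \<oplus>\<^bsub>V\<^esub> lin_ext R V \<phi> d" .
  next
    fix k c assume k: "k \<in> carrier R" and c: "c \<in> carrier (free_vs R S)"
    let ?A = "{s. c s \<noteq> \<zero>}"
    have A: "finite ?A" "?A \<subseteq> S" using supp[OF c] by auto
    have sub: "{s. (k \<odot>\<^bsub>free_vs R S\<^esub> c) s \<noteq> \<zero>} \<subseteq> ?A" using k by auto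
    have "lin_ext R V \<phi> (k \<odot>\<^bsub>free_vs R S\<^esub> c) = (\<Oplus>\<^bsub>V\<^esub> s \<in> ?A. (k \<odot>\<^bsub>free_vs R S\<^esub> c) s \<odot>\<^bsub>V\<^esub> \<phi> s)"
      using lin_ext_superset[OF V \<phi> F.smult_closed[OF k c] A(1) sub A(2)] .
    also have "\<dots> = (\<Oplus>\<^bsub>V\<^esub> s \<in> ?A. k \<odot>\<^bsub>V\<^esub> (c s \<odot>\<^bsub>V\<^esub> \<phi> s))"
      by (rule V.finsum_cong')
        (use A k term_closed[OF c] \<phi> free_vs_coeff[OF c] in \<open>auto simp: V.smult_assoc1 subset_iff\<close>)
    also have "\<dots> = k \<odot>\<^bsub>V\<^esub> lin_ext R V \<phi> c" unfolding lin_ext_def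
      by (rule V.finsum_smult_ldistr[symmetric]) (use A k term_closed[OF c] in auto)
    finally show "lin_ext R V \<phi> (k \<odot>\<^bsub>free_vs R S\<^esub> c) = k \<odot>\<^bsub>V\<^esub> lin_ext R V \<phi> c" .
  qed
qed

lemma (in cring) lin_ext_free_gen:
  assumes V: "module R V" and \<phi>: "\<And>s. s \<in> S \<Longrightarrow> \<phi> s \<in> carrier V" and s: "s \<in> S"
  shows "lin_ext R V \<phi> (free_gen R s) = \<phi> s"
proof -
  interpret V: module R V by fact
  have "lin_ext R V \<phi> (free_gen R s) = (\<Oplus>\<^bsub>V\<^esub> t \<in> {s}. free_gen R s t \<odot>\<^bsub>V\<^esub> \<phi> t)"
    by (rule lin_ext_superset[OF V \<phi> free_gen_closed[OF s]]) (use s in \<open>auto simp: free_gen_def\<close>)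
  then show ?thesis using \<phi>[OF s] by (simp add: free_gen_def V.finsum_insert)
qed

lemma (in cring) free_vs_linear_ext:
  assumes V: "module R V"
    and h: "linear_on R (free_vs R S) V h" and h': "linear_on R (free_vs R S) V h'"
    and eq: "\<And>s. s \<in> S \<Longrightarrow> h (free_gen R s) = h' (free_gen R s)"
    and c: "c \<in> carrier (free_vs R S)"
  shows "h c = h' c"
proof -
  interpret V: module R V by fact
  have "submodule {c \<in> carrier (free_vs R S). h c \<ominus>\<^bsub>V\<^esub> h' c \<in> {\<zero>\<^bsub>V\<^esub>}} R (free_vs R S)"
    by (rule linear_on_vimage[OF free_vs_module V linear_on_diff[OF V h h'] zero_submodule[OF V]])
  then have "carrier (free_vs R S) \<subseteq> {c \<in> carrier (free_vs R S). h c \<ominus>\<^bsub>V\<^esub> h' c \<in> {\<zero>\<^bsub>V\<^esub>}}"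
    by (rule free_vs_subset_submodule)
      (simp add: eq free_gen_closed linear_on_closed[OF h'] V.r_neg V.minus_eq)
  then show ?thesis
    using c linear_on_closed[OF h c] linear_on_closed[OF h' c]
    by (auto intro: minus_zero_imp_eq[OF V.abelian_group_axioms])
qed

section \<open>Quotient modules\<close>

text \<open>
  The quotient is described through its fields only, so that the result applies to the record of the
  tensor product, which has further operations.
\<close>

lemma quotient_module:
  fixes F :: "('k, 'f, 'x) module_scheme" and Q :: "('k, 'f set, 'y) module_scheme"
  assumes F: "module K F" and H: "submodule H K F"
    and Q: "carrier Q = a_rcosets\<^bsub>F\<^esub> H" "zero Q = H" "add Q = set_add F"
      "smult Q = (\<lambda>k X. \<Union>x\<in>X. H +>\<^bsub>F\<^esub> (k \<odot>\<^bsub>F\<^esub> x))"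
  shows "module K Q" and "linear_on K F Q (\<lambda>x. H +>\<^bsub>F\<^esub> x)"
    and "carrier Q = (\<lambda>x. H +>\<^bsub>F\<^esub> x) ` carrier F"
    and "\<And>x y. \<lbrakk>x \<in> carrier F; y \<in> carrier F\<rbrakk> \<Longrightarrow> H +>\<^bsub>F\<^esub> x = H +>\<^bsub>F\<^esub> y \<longleftrightarrow> x \<ominus>\<^bsub>F\<^esub> y \<in> H"
    and "\<And>x y. \<lbrakk>x \<in> carrier F; y \<in> H +>\<^bsub>F\<^esub> x\<rbrakk> \<Longrightarrow> y \<in> carrier F \<and> y \<ominus>\<^bsub>F\<^esub> x \<in> H"
    and "\<And>x. x \<in> carrier F \<Longrightarrow> x \<in> H +>\<^bsub>F\<^esub> x"
proof -
  interpret F: module K F by fact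
  note Hs = F.submoduleE[OF H]
  interpret H: abelian_subgroup H F
    by (rule abelian_subgroupI3)
      (auto simp: additive_subgroup_def submodule.axioms(1)[OF H] F.abelian_group_axioms)
  let ?cls = "\<lambda>x. H +>\<^bsub>F\<^esub> x"
  show car: "carrier Q = ?cls ` carrier F" by (auto simp: Q A_RCOSETS_def')
  have mem_iff: "y \<in> ?cls x \<longleftrightarrow> y \<in> carrier F \<and> y \<ominus>\<^bsub>F\<^esub> x \<in> H" if x: "x \<in> carrier F" for x y
  proof
    assume "y \<in> ?cls x"
    then obtain h where h: "h \<in> H" "y = h \<oplus>\<^bsub>F\<^esub> x" by (auto simp: a_r_coset_def')
    then show "y \<in> carrier F \<and> y \<ominus>\<^bsub>F\<^esub> x \<in> H"
      using x Hs(1) by (auto simp: a_minus_def F.a_assoc F.r_neg subset_iff)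
  next
    assume y: "y \<in> carrier F \<and> y \<ominus>\<^bsub>F\<^esub> x \<in> H"
    then have "y = (y \<ominus>\<^bsub>F\<^esub> x) \<oplus>\<^bsub>F\<^esub> x" using x by (simp add: a_minus_def F.a_assoc F.l_neg)
    then show "y \<in> ?cls x" using y by (auto simp: a_r_coset_def')
  qed
  then show mem: "y \<in> carrier F \<and> y \<ominus>\<^bsub>F\<^esub> x \<in> H" if "x \<in> carrier F" "y \<in> ?cls x" for x y
    using that by blast
  show eq: "?cls x = ?cls y \<longleftrightarrow> x \<ominus>\<^bsub>F\<^esub> y \<in> H" if "x \<in> carrier F" "y \<in> carrier F" for x y
    using that mem_iff[of y x] H.a_rcos_self[of x] H.a_repr_independence'[of x y] by auto
  show self: "x \<in> ?cls x" if "x \<in> carrier F" for x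
    using that by (rule H.a_rcos_self)
  have addc: "?cls x \<oplus>\<^bsub>Q\<^esub> ?cls y = ?cls (x \<oplus>\<^bsub>F\<^esub> y)" if "x \<in> carrier F" "y \<in> carrier F" for x y
    using that by (simp add: Q H.a_rcos_sum)
  have smultc: "k \<odot>\<^bsub>Q\<^esub> ?cls x = ?cls (k \<odot>\<^bsub>F\<^esub> x)" if "k \<in> carrier K" "x \<in> carrier F" for k x
  proof -
    have "?cls (k \<odot>\<^bsub>F\<^esub> y) = ?cls (k \<odot>\<^bsub>F\<^esub> x)" if y: "y \<in> ?cls x" for y
    proof -
      have "y \<in> carrier F" "y \<ominus>\<^bsub>F\<^esub> x \<in> H" using mem \<open>x \<in> carrier F\<close> y by auto
      moreover have "k \<odot>\<^bsub>F\<^esub> y \<ominus>\<^bsub>F\<^esub> k \<odot>\<^bsub>F\<^esub> x = k \<odot>\<^bsub>F\<^esub> (y \<ominus>\<^bsub>F\<^esub> x)"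
        using calculation \<open>k \<in> carrier K\<close> \<open>x \<in> carrier F\<close>
        by (simp add: a_minus_def F.smult_r_distr F.smult_r_minus)
      ultimately show ?thesis using eq \<open>k \<in> carrier K\<close> \<open>x \<in> carrier F\<close> Hs(4) by simp
    qed
    then show ?thesis using self[OF that(2)] unfolding Q by blast
  qed
  show lin: "linear_on K F Q ?cls"
    by (rule linear_onI) (auto simp: car addc smultc)
  have zeroc: "\<zero>\<^bsub>Q\<^esub> = ?cls \<zero>\<^bsub>F\<^esub>"
    by (simp add: Q F.a_coset_add_zero Hs(1))
  show "module K Q"
  proof (rule moduleI)
    show "abelian_group Q"
    proof (rule abelian_groupI)
      show "\<exists>Y\<in>carrier Q. Y \<oplus>\<^bsub>Q\<^esub> X = \<zero>\<^bsub>Q\<^esub>" if "X \<in> carrier Q" for X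
      proof -
        obtain x where x: "x \<in> carrier F" "X = ?cls x" using \<open>X \<in> carrier Q\<close> unfolding car by blast
        then have "?cls (\<ominus>\<^bsub>F\<^esub> x) \<oplus>\<^bsub>Q\<^esub> X = \<zero>\<^bsub>Q\<^esub>" by (simp add: addc zeroc F.l_neg)
        then show ?thesis using x by (auto simp: car)
      qed
    qed (auto simp: car addc zeroc F.a_ac)
  qed (auto simp: car addc smultc F.is_cring F.smult_l_distr F.smult_r_distr F.smult_assoc1)
qed

section \<open>Mutual actions\<close>

lemma acts_on_bilinear:
  assumes "acts_on K A M \<alpha>"
  shows "bilinear_on K A M M (ldot \<alpha>)" "bilinear_on K M A M (rdot \<alpha>)"
    "bilinear_on K A M M (lstar \<alpha>)" "bilinear_on K M A M (rstar \<alpha>)"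
  using assms by (simp_all add: acts_on_def)

lemma acts_on_eqs:
  assumes "acts_on K A M \<alpha>" "a \<in> carrier A" "m1 \<in> carrier M"
  shows "a' \<in> carrier A \<Longrightarrow> ldot \<alpha> (a \<otimes>\<^bsub>A\<^esub> a') m1 = ldot \<alpha> a (ldot \<alpha> a' m1)"
    "a' \<in> carrier A \<Longrightarrow> rdot \<alpha> m1 (a \<otimes>\<^bsub>A\<^esub> a') = rdot \<alpha> (rdot \<alpha> m1 a) a'"
    "a' \<in> carrier A \<Longrightarrow> rdot \<alpha> (ldot \<alpha> a m1) a' = ldot \<alpha> a (rdot \<alpha> m1 a')"
    "a' \<in> carrier A \<Longrightarrow> rstar \<alpha> (ldot \<alpha> a m1) a' = ldot \<alpha> a (rstar \<alpha> m1 a') \<oplus>\<^bsub>M\<^esub> ldot \<alpha> \<lbrace>a, a'\<rbrace>\<^bsub>A\<^esub> m1"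
    "a' \<in> carrier A \<Longrightarrow> rstar \<alpha> (rdot \<alpha> m1 a) a' = rdot \<alpha> (rstar \<alpha> m1 a') a \<oplus>\<^bsub>M\<^esub> rdot \<alpha> m1 \<lbrace>a, a'\<rbrace>\<^bsub>A\<^esub>"
    "a' \<in> carrier A \<Longrightarrow> lstar \<alpha> (a \<otimes>\<^bsub>A\<^esub> a') m1 = ldot \<alpha> a (lstar \<alpha> a' m1) \<oplus>\<^bsub>M\<^esub> rdot \<alpha> (lstar \<alpha> a m1) a'"
    "m2 \<in> carrier M \<Longrightarrow> rdot \<alpha> (m1 \<otimes>\<^bsub>M\<^esub> m2) a = m1 \<otimes>\<^bsub>M\<^esub> rdot \<alpha> m2 a"
    "m2 \<in> carrier M \<Longrightarrow> ldot \<alpha> a (m1 \<otimes>\<^bsub>M\<^esub> m2) = ldot \<alpha> a m1 \<otimes>\<^bsub>M\<^esub> m2"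
    "m2 \<in> carrier M \<Longrightarrow> rdot \<alpha> m1 a \<otimes>\<^bsub>M\<^esub> m2 = m1 \<otimes>\<^bsub>M\<^esub> ldot \<alpha> a m2"
    "m2 \<in> carrier M \<Longrightarrow> \<lbrace>rdot \<alpha> m1 a, m2\<rbrace>\<^bsub>M\<^esub> = m1 \<otimes>\<^bsub>M\<^esub> lstar \<alpha> a m2 \<oplus>\<^bsub>M\<^esub> rdot \<alpha> \<lbrace>m1, m2\<rbrace>\<^bsub>M\<^esub> a"
    "m2 \<in> carrier M \<Longrightarrow> \<lbrace>ldot \<alpha> a m1, m2\<rbrace>\<^bsub>M\<^esub> = ldot \<alpha> a \<lbrace>m1, m2\<rbrace>\<^bsub>M\<^esub> \<oplus>\<^bsub>M\<^esub> lstar \<alpha> a m2 \<otimes>\<^bsub>M\<^esub> m1"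
    "m2 \<in> carrier M \<Longrightarrow> rstar \<alpha> (m1 \<otimes>\<^bsub>M\<^esub> m2) a = m1 \<otimes>\<^bsub>M\<^esub> rstar \<alpha> m2 a \<oplus>\<^bsub>M\<^esub> rstar \<alpha> m1 a \<otimes>\<^bsub>M\<^esub> m2"
  using assms by (simp_all add: acts_on_def)

locale compatible_awbs = M: awb K M + N: awb K N
  for K :: "('k, 'r) ring_scheme" and M :: "('k, 'm) awb" and N :: "('k, 'n) awb" +
  fixes \<mu> :: "('m, 'n) awb_action" and \<nu> :: "('n, 'm) awb_action"
  assumes compatible: "compatible_actions K M N \<mu> \<nu>"
begin

lemma acts: "acts_on K M N \<mu>" "acts_on K N M \<nu>"
  using compatible by (auto simp: compatible_actions_def)

text \<open>
  The data are symmetric in \<open>M\<close> and \<open>N\<close>, and so each fact about one of the two actions also holds for the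
  other.
\<close>

lemma swap: "compatible_awbs K N M \<nu> \<mu>"
proof -
  have "(u\<^sub>M, u\<^sub>N) \<in> basic_pairs M N \<mu> \<nu>" if "(u\<^sub>N, u\<^sub>M) \<in> basic_pairs N M \<nu> \<mu>" for u\<^sub>M u\<^sub>N
  proof -
    from that obtain g where g: "g \<in> tgens N M" "gen_pair \<nu> \<mu> g = (u\<^sub>N, u\<^sub>M)"
      by (auto simp: basic_pairs_def)
    define g' where "g' = (case g of DotMN n m \<Rightarrow> DotNM n m | DotNM m n \<Rightarrow> DotMN m n
      | StarMN n m \<Rightarrow> StarNM n m | StarNM m n \<Rightarrow> StarMN m n)"
    have "g' \<in> tgens M N" "gen_pair \<mu> \<nu> g' = (u\<^sub>M, u\<^sub>N)"
      using g by (auto simp: tgens_def g'_def)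
    then show ?thesis by (metis basic_pairs_def imageI)
  qed
  then have "compatible_actions K N M \<nu> \<mu>"
    using compatible unfolding compatible_actions_def by fast
  then show ?thesis
    by (intro compatible_awbs.intro compatible_awbs_axioms.intro M.awb_axioms N.awb_axioms)
qed

lemma action_closed [simp]:
  assumes "m \<in> carrier M" "n \<in> carrier N"
  shows "ldot \<mu> m n \<in> carrier N" "rdot \<mu> n m \<in> carrier N" "lstar \<mu> m n \<in> carrier N"
    "rstar \<mu> n m \<in> carrier N" "ldot \<nu> n m \<in> carrier M" "rdot \<nu> m n \<in> carrier M"
    "lstar \<nu> n m \<in> carrier M" "rstar \<nu> m n \<in> carrier M"
  using assms acts by (auto simp: acts_on_def bilinear_on_def)

lemma mult_closed [simp]:
  "a \<in> carrier M \<Longrightarrow> b \<in> carrier M \<Longrightarrow> a \<otimes>\<^bsub>M\<^esub> b \<in> carrier M"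
  "a \<in> carrier M \<Longrightarrow> b \<in> carrier M \<Longrightarrow> \<lbrace>a, b\<rbrace>\<^bsub>M\<^esub> \<in> carrier M"
  by (auto intro: bilinear_on_closed[OF M.mult_bilinear] bilinear_on_closed[OF M.bracket_bilinear])

lemma gen_pair_closed:
  assumes "g \<in> tgens M N"
  shows "fst (gen_pair \<mu> \<nu> g) \<in> carrier M" "snd (gen_pair \<mu> \<nu> g) \<in> carrier N"
  using assms by (auto simp: tgens_def)

lemma basic_action:
  assumes "g \<in> tgens M N"
  defines "u\<^sub>M \<equiv> fst (gen_pair \<mu> \<nu> g)" and "u\<^sub>N \<equiv> snd (gen_pair \<mu> \<nu> g)"
  shows "m \<in> carrier M \<Longrightarrow> rdot \<nu> m u\<^sub>N = m \<otimes>\<^bsub>M\<^esub> u\<^sub>M"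
    "m \<in> carrier M \<Longrightarrow> rstar \<nu> m u\<^sub>N = \<lbrace>m, u\<^sub>M\<rbrace>\<^bsub>M\<^esub>"
    "m \<in> carrier M \<Longrightarrow> ldot \<nu> u\<^sub>N m = u\<^sub>M \<otimes>\<^bsub>M\<^esub> m"
    "m \<in> carrier M \<Longrightarrow> lstar \<nu> u\<^sub>N m = \<lbrace>u\<^sub>M, m\<rbrace>\<^bsub>M\<^esub>"
    "n \<in> carrier N \<Longrightarrow> rdot \<mu> n u\<^sub>M = n \<otimes>\<^bsub>N\<^esub> u\<^sub>N"
    "n \<in> carrier N \<Longrightarrow> rstar \<mu> n u\<^sub>M = \<lbrace>n, u\<^sub>N\<rbrace>\<^bsub>N\<^esub>"
    "n \<in> carrier N \<Longrightarrow> ldot \<mu> u\<^sub>M n = u\<^sub>N \<otimes>\<^bsub>N\<^esub> n"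
    "n \<in> carrier N \<Longrightarrow> lstar \<mu> u\<^sub>M n = \<lbrace>u\<^sub>N, n\<rbrace>\<^bsub>N\<^esub>"
proof -
  have "(u\<^sub>M, u\<^sub>N) \<in> basic_pairs M N \<mu> \<nu>"
    using assms(1) by (auto simp: basic_pairs_def u\<^sub>M_def u\<^sub>N_def)
  then have *: "\<forall>m\<in>carrier M. \<forall>n\<in>carrier N.
      rdot \<nu> m u\<^sub>N = m \<otimes>\<^bsub>M\<^esub> u\<^sub>M \<and> rstar \<nu> m u\<^sub>N = \<lbrace>m, u\<^sub>M\<rbrace>\<^bsub>M\<^esub> \<and>
      ldot \<nu> u\<^sub>N m = u\<^sub>M \<otimes>\<^bsub>M\<^esub> m \<and> lstar \<nu> u\<^sub>N m = \<lbrace>u\<^sub>M, m\<rbrace>\<^bsub>M\<^esub> \<and>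
      rdot \<mu> n u\<^sub>M = n \<otimes>\<^bsub>N\<^esub> u\<^sub>N \<and> rstar \<mu> n u\<^sub>M = \<lbrace>n, u\<^sub>N\<rbrace>\<^bsub>N\<^esub> \<and>
      ldot \<mu> u\<^sub>M n = u\<^sub>N \<otimes>\<^bsub>N\<^esub> n \<and> lstar \<mu> u\<^sub>M n = \<lbrace>u\<^sub>N, n\<rbrace>\<^bsub>N\<^esub>"
    using compatible unfolding compatible_actions_def by fast
  show "rdot \<nu> m u\<^sub>N = m \<otimes>\<^bsub>M\<^esub> u\<^sub>M" "rstar \<nu> m u\<^sub>N = \<lbrace>m, u\<^sub>M\<rbrace>\<^bsub>M\<^esub>"
    "ldot \<nu> u\<^sub>N m = u\<^sub>M \<otimes>\<^bsub>M\<^esub> m" "lstar \<nu> u\<^sub>N m = \<lbrace>u\<^sub>M, m\<rbrace>\<^bsub>M\<^esub>" if "m \<in> carrier M"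
    using bspec[OF bspec[OF * that] N.zero_closed] by blast+
  show "rdot \<mu> n u\<^sub>M = n \<otimes>\<^bsub>N\<^esub> u\<^sub>N" "rstar \<mu> n u\<^sub>M = \<lbrace>n, u\<^sub>N\<rbrace>\<^bsub>N\<^esub>"
    "ldot \<mu> u\<^sub>M n = u\<^sub>N \<otimes>\<^bsub>N\<^esub> n" "lstar \<mu> u\<^sub>M n = \<lbrace>u\<^sub>N, n\<rbrace>\<^bsub>N\<^esub>" if "n \<in> carrier N"
    using bspec[OF bspec[OF * M.zero_closed] that] by blast+
qed

text \<open>
  Compatibility for each of the four families of basic pairs separately, as rewrite rules: this is the
  form in which actions of basic pairs occur in the relations.
\<close>

lemma basic_action_simps:
  assumes "m \<in> carrier M" "m' \<in> carrier M" "n \<in> carrier N"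
  shows
    "rdot \<nu> m (ldot \<mu> m' n) = m \<otimes>\<^bsub>M\<^esub> rdot \<nu> m' n" "ldot \<nu> (ldot \<mu> m' n) m = rdot \<nu> m' n \<otimes>\<^bsub>M\<^esub> m"
    "lstar \<nu> (ldot \<mu> m' n) m = \<lbrace>rdot \<nu> m' n, m\<rbrace>\<^bsub>M\<^esub>"
    "rdot \<nu> m (rdot \<mu> n m') = m \<otimes>\<^bsub>M\<^esub> ldot \<nu> n m'" "ldot \<nu> (rdot \<mu> n m') m = ldot \<nu> n m' \<otimes>\<^bsub>M\<^esub> m"
    "lstar \<nu> (rdot \<mu> n m') m = \<lbrace>ldot \<nu> n m', m\<rbrace>\<^bsub>M\<^esub>"
    "rdot \<nu> m (lstar \<mu> m' n) = m \<otimes>\<^bsub>M\<^esub> rstar \<nu> m' n" "ldot \<nu> (lstar \<mu> m' n) m = rstar \<nu> m' n \<otimes>\<^bsub>M\<^esub> m"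
    "rdot \<nu> m (rstar \<mu> n m') = m \<otimes>\<^bsub>M\<^esub> lstar \<nu> n m'" "ldot \<nu> (rstar \<mu> n m') m = lstar \<nu> n m' \<otimes>\<^bsub>M\<^esub> m"
proof -
  have "DotMN m' n \<in> tgens M N" "DotNM n m' \<in> tgens M N" "StarMN m' n \<in> tgens M N" "StarNM n m' \<in> tgens M N"
    using assms by (auto simp: tgens_def)
  note this[THEN basic_action(1)[OF _ assms(1)]] this[THEN basic_action(3)[OF _ assms(1)]]
    this[THEN basic_action(4)[OF _ assms(1)]]
  then show
    "rdot \<nu> m (ldot \<mu> m' n) = m \<otimes>\<^bsub>M\<^esub> rdot \<nu> m' n" "ldot \<nu> (ldot \<mu> m' n) m = rdot \<nu> m' n \<otimes>\<^bsub>M\<^esub> m"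
    "lstar \<nu> (ldot \<mu> m' n) m = \<lbrace>rdot \<nu> m' n, m\<rbrace>\<^bsub>M\<^esub>"
    "rdot \<nu> m (rdot \<mu> n m') = m \<otimes>\<^bsub>M\<^esub> ldot \<nu> n m'" "ldot \<nu> (rdot \<mu> n m') m = ldot \<nu> n m' \<otimes>\<^bsub>M\<^esub> m"
    "lstar \<nu> (rdot \<mu> n m') m = \<lbrace>ldot \<nu> n m', m\<rbrace>\<^bsub>M\<^esub>"
    "rdot \<nu> m (lstar \<mu> m' n) = m \<otimes>\<^bsub>M\<^esub> rstar \<nu> m' n" "ldot \<nu> (lstar \<mu> m' n) m = rstar \<nu> m' n \<otimes>\<^bsub>M\<^esub> m"
    "rdot \<nu> m (rstar \<mu> n m') = m \<otimes>\<^bsub>M\<^esub> lstar \<nu> n m'" "ldot \<nu> (rstar \<mu> n m') m = lstar \<nu> n m' \<otimes>\<^bsub>M\<^esub> m"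
    by simp_all
qed

end

section \<open>Relations\<close>

text \<open>
  The relations between basic pairs, indexed by symbols instead of by pairs: a linear map can then be
  evaluated on them directly.
\<close>

definition basic_rels ::
  "('k, 'f) awb \<Rightarrow> ('k, 'm) awb \<Rightarrow> ('k, 'n) awb \<Rightarrow> ('m, 'n) awb_action \<Rightarrow> ('n, 'm) awb_action \<Rightarrow>
   ('m \<Rightarrow> 'n \<Rightarrow> 'f) \<Rightarrow> ('n \<Rightarrow> 'm \<Rightarrow> 'f) \<Rightarrow> ('m \<Rightarrow> 'n \<Rightarrow> 'f) \<Rightarrow> ('n \<Rightarrow> 'm \<Rightarrow> 'f) \<Rightarrow> 'f set"
  where "basic_rels F M N \<mu> \<nu> d d' s s' =
    (\<Union>g\<in>tgens M N. \<Union>h\<in>tgens M N.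
      {d (fst (gen_pair \<mu> \<nu> g)) (snd (gen_pair \<mu> \<nu> h)) \<ominus>\<^bsub>F\<^esub> d' (snd (gen_pair \<mu> \<nu> g)) (fst (gen_pair \<mu> \<nu> h)),
       s (fst (gen_pair \<mu> \<nu> g)) (snd (gen_pair \<mu> \<nu> h)) \<ominus>\<^bsub>F\<^esub> s' (snd (gen_pair \<mu> \<nu> g)) (fst (gen_pair \<mu> \<nu> h))})"

lemma bilinearity_relsI:
  assumes "u \<in> carrier U" "v \<in> carrier V"
  shows "k \<in> carrier K \<Longrightarrow> k \<odot>\<^bsub>F\<^esub> d u v \<ominus>\<^bsub>F\<^esub> d (k \<odot>\<^bsub>U\<^esub> u) v \<in> bilinearity_rels K F U V d"
    "k \<in> carrier K \<Longrightarrow> k \<odot>\<^bsub>F\<^esub> d u v \<ominus>\<^bsub>F\<^esub> d u (k \<odot>\<^bsub>V\<^esub> v) \<in> bilinearity_rels K F U V d"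
    "u' \<in> carrier U \<Longrightarrow> d (u \<oplus>\<^bsub>U\<^esub> u') v \<ominus>\<^bsub>F\<^esub> (d u v \<oplus>\<^bsub>F\<^esub> d u' v) \<in> bilinearity_rels K F U V d"
    "v' \<in> carrier V \<Longrightarrow> d u (v \<oplus>\<^bsub>V\<^esub> v') \<ominus>\<^bsub>F\<^esub> (d u v \<oplus>\<^bsub>F\<^esub> d u v') \<in> bilinearity_rels K F U V d"
proof -
  note I = UN_I[OF assms(1)] UN_I[OF assms(2)]
  show "k \<odot>\<^bsub>F\<^esub> d u v \<ominus>\<^bsub>F\<^esub> d (k \<odot>\<^bsub>U\<^esub> u) v \<in> bilinearity_rels K F U V d"
    "k \<odot>\<^bsub>F\<^esub> d u v \<ominus>\<^bsub>F\<^esub> d u (k \<odot>\<^bsub>V\<^esub> v) \<in> bilinearity_rels K F U V d" if "k \<in> carrier K"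
    unfolding bilinearity_rels_def by (rule UnI1, rule UnI1, rule UN_I[OF that], rule I, rule I, simp)+
  show "d (u \<oplus>\<^bsub>U\<^esub> u') v \<ominus>\<^bsub>F\<^esub> (d u v \<oplus>\<^bsub>F\<^esub> d u' v) \<in> bilinearity_rels K F U V d" if "u' \<in> carrier U"
    unfolding bilinearity_rels_def
    by (rule UnI1, rule UnI2, rule I(1), rule UN_I[OF that], rule I(2), simp)
  show "d u (v \<oplus>\<^bsub>V\<^esub> v') \<ominus>\<^bsub>F\<^esub> (d u v \<oplus>\<^bsub>F\<^esub> d u v') \<in> bilinearity_rels K F U V d" if "v' \<in> carrier V"
    unfolding bilinearity_rels_def
    by (rule UnI2, rule I(1), rule I(2), rule UN_I[OF that], simp)
qed

lemma action_relsI: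
  assumes "m1 \<in> carrier M" "m2 \<in> carrier M" "n \<in> carrier N"
  shows "d (m1 \<otimes>\<^bsub>M\<^esub> m2) n \<ominus>\<^bsub>F\<^esub> d m1 (ldot \<mu> m2 n) \<in> action_rels F M N \<mu> d d' s s'"
    "s (m1 \<otimes>\<^bsub>M\<^esub> m2) n \<ominus>\<^bsub>F\<^esub> (d m1 (lstar \<mu> m2 n) \<oplus>\<^bsub>F\<^esub> d' (lstar \<mu> m1 n) m2)
      \<in> action_rels F M N \<mu> d d' s s'"
  unfolding action_rels_def
  by (rule UN_I[OF assms(1)], rule UN_I[OF assms(2)], rule UN_I[OF assms(3)], simp)+

lemma bilinearity_rels_killed:
  fixes F :: "('k, 'f) awb"
  assumes F: "module K F" and V: "module K V" and p: "linear_on K F V p"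
    and mods: "module K M" "module K N"
    and b: "bilinear_on K M N V b"
    and d: "\<And>m n. \<lbrakk>m \<in> carrier M; n \<in> carrier N\<rbrakk> \<Longrightarrow> d m n \<in> carrier F \<and> p (d m n) = b m n"
  shows "bilinearity_rels K F M N d \<subseteq> {r \<in> carrier F. p r = \<zero>\<^bsub>V\<^esub>}"
proof -
  interpret F: module K F by fact
  interpret V: module K V by fact
  interpret M: module K M by fact
  interpret N: module K N by fact
  define Z where "Z = {r \<in> carrier F. p r = \<zero>\<^bsub>V\<^esub>}"
  have step: "x \<ominus>\<^bsub>F\<^esub> y \<in> Z" if "x \<in> carrier F" "y \<in> carrier F" "p x = p y" for x y
    using that linear_on_closed[OF p] by (simp add: Z_def linear_on_minus[OF F V p] V.r_neg V.minus_eq)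
  have bl: "b m n \<in> carrier V" if "m \<in> carrier M" "n \<in> carrier N" for m n
    using bilinear_on_closed[OF b that] .
  have "bilinearity_rels K F M N d \<subseteq> Z"
    unfolding bilinearity_rels_def
    by (auto intro!: step simp: d linear_on_add[OF p] linear_on_smult[OF p] bl
        linear_on_add[OF bilinear_on_left[OF b]] linear_on_add[OF bilinear_on_right[OF b]]
        linear_on_smult[OF bilinear_on_left[OF b]] linear_on_smult[OF bilinear_on_right[OF b]])
  then show ?thesis by (simp add: Z_def)
qed

context compatible_awbs
begin

text \<open>
  On the relations in which products of \<open>M\<close> are resolved, the projection to \<open>M\<close> vanishes by compatibility
  (an element of \<open>N\<close> from a basic pair acts on \<open>M\<close> as its partner) combined with the axioms that describe
  how an action of \<open>N\<close> interacts with products and brackets of \<open>M\<close>.  The projection to \<open>N\<close> vanishes on them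
  by the module-like axioms of the action of \<open>M\<close> alone.  The symbols are parameters, so exchanging \<open>M\<close> and
  \<open>N\<close> yields the statements about the second half of the relations.
\<close>

lemma action_rels_killed_left:
  fixes F :: "('k, 'f) awb"
  assumes F: "module K F" and p: "linear_on K F M p"
    and gens: "\<And>m n. \<lbrakk>m \<in> carrier M; n \<in> carrier N\<rbrakk> \<Longrightarrow>
      d m n \<in> carrier F \<and> d' n m \<in> carrier F \<and> s m n \<in> carrier F \<and> s' n m \<in> carrier F \<and>
      p (d m n) = rdot \<nu> m n \<and> p (d' n m) = ldot \<nu> n m \<and>
      p (s m n) = rstar \<nu> m n \<and> p (s' n m) = lstar \<nu> n m"
  shows "action_rels F M N \<mu> d d' s s' \<subseteq> {r \<in> carrier F. p r = \<zero>\<^bsub>M\<^esub>}"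
proof -
  interpret F: module K F by fact
  define Z where "Z = {r \<in> carrier F. p r = \<zero>\<^bsub>M\<^esub>}"
  have step: "x \<ominus>\<^bsub>F\<^esub> y \<in> Z" if "x \<in> carrier F" "y \<in> carrier F" "p x = p y" for x y
    using that linear_on_closed[OF p]
    by (simp add: Z_def linear_on_minus[OF F M.module_axioms p] M.r_neg M.minus_eq)
  have "action_rels F M N \<mu> d d' s s' \<subseteq> Z"
    unfolding action_rels_def
    by (auto intro!: step simp: gens linear_on_add[OF p] basic_action_simps acts_on_eqs[OF acts(2)] M.a_comm)
  then show ?thesis by (simp add: Z_def)
qed

lemma action_rels_killed_right:
  fixes F :: "('k, 'f) awb"
  assumes F: "module K F" and p: "linear_on K F N p"
    and gens: "\<And>m n. \<lbrakk>m \<in> carrier M; n \<in> carrier N\<rbrakk> \<Longrightarrow>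
      d m n \<in> carrier F \<and> d' n m \<in> carrier F \<and> s m n \<in> carrier F \<and> s' n m \<in> carrier F \<and>
      p (d m n) = ldot \<mu> m n \<and> p (d' n m) = rdot \<mu> n m \<and>
      p (s m n) = lstar \<mu> m n \<and> p (s' n m) = rstar \<mu> n m"
  shows "action_rels F M N \<mu> d d' s s' \<subseteq> {r \<in> carrier F. p r = \<zero>\<^bsub>N\<^esub>}"
proof -
  interpret F: module K F by fact
  define Z where "Z = {r \<in> carrier F. p r = \<zero>\<^bsub>N\<^esub>}"
  have step: "x \<ominus>\<^bsub>F\<^esub> y \<in> Z" if "x \<in> carrier F" "y \<in> carrier F" "p x = p y" for x y
    using that linear_on_closed[OF p]
    by (simp add: Z_def linear_on_minus[OF F N.module_axioms p] N.r_neg N.minus_eq)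
  have "action_rels F M N \<mu> d d' s s' \<subseteq> Z"
    unfolding action_rels_def
    by (auto intro!: step simp: gens linear_on_add[OF p] acts_on_eqs[OF acts(1)])
  then show ?thesis by (simp add: Z_def)
qed

end

section \<open>The tensor product is an algebra with bracket\<close>

lemma pre_tensor_simps:
  "carrier (pre_tensor K M N \<mu> \<nu>) = carrier (free_vs K (tgens M N))"
  "zero (pre_tensor K M N \<mu> \<nu>) = zero (free_vs K (tgens M N))"
  "add (pre_tensor K M N \<mu> \<nu>) = add (free_vs K (tgens M N))"
  "smult (pre_tensor K M N \<mu> \<nu>) = smult (free_vs K (tgens M N))"
  "mult (pre_tensor K M N \<mu> \<nu>) = (\<lambda>c d. lin_ext K (free_vs K (tgens M N)) (\<lambda>g. lin_ext K (free_vs K (tgens M N))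
       (\<lambda>h. free_gen K (DotMN (fst (gen_pair \<mu> \<nu> g)) (snd (gen_pair \<mu> \<nu> h)))) d) c)"
  "bracket (pre_tensor K M N \<mu> \<nu>) = (\<lambda>c d. lin_ext K (free_vs K (tgens M N)) (\<lambda>g. lin_ext K (free_vs K (tgens M N))
       (\<lambda>h. free_gen K (StarMN (fst (gen_pair \<mu> \<nu> g)) (snd (gen_pair \<mu> \<nu> h)))) d) c)"
  by (simp_all add: pre_tensor_def Let_def)

lemma linear_on_pre_tensor:
  "linear_on K (pre_tensor K M N \<mu> \<nu>) V h \<longleftrightarrow> linear_on K (free_vs K (tgens M N)) V h"
  "linear_on K U (pre_tensor K M N \<mu> \<nu>) h' \<longleftrightarrow> linear_on K U (free_vs K (tgens M N)) h'"
  by (simp_all only: linear_on_def pre_tensor_simps)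

context compatible_awbs
begin

abbreviation "F \<equiv> pre_tensor K M N \<mu> \<nu>"
abbreviation "R \<equiv> tensor_ker K M N \<mu> \<nu>"
abbreviation "T \<equiv> tensor K M N \<mu> \<nu>"

text \<open>
  The pairs \<open>(prM x, prN x)\<close> are exactly the linear combinations of basic pairs, so a property of basic
  pairs that is linear in the pair extends to all of them.
\<close>

definition prM where "prM = lin_ext K M (\<lambda>g. fst (gen_pair \<mu> \<nu> g))"
definition prN where "prN = lin_ext K N (\<lambda>g. snd (gen_pair \<mu> \<nu> g))"
definition cls where "cls x = R +>\<^bsub>F\<^esub> x"

lemma module_F: "module K F"
  by (rule module_cong[OF M.free_vs_module[of "tgens M N"]]) (simp_all add: pre_tensor_simps)

lemma gen_closed: "g \<in> tgens M N \<Longrightarrow> free_gen K g \<in> carrier F"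
  by (simp add: pre_tensor_simps M.free_gen_closed)

lemma symbol_closed [simp]:
  assumes "m \<in> carrier M" "n \<in> carrier N"
  shows "free_gen K (DotMN m n) \<in> carrier F" "free_gen K (DotNM n m) \<in> carrier F"
    "free_gen K (StarMN m n) \<in> carrier F" "free_gen K (StarNM n m) \<in> carrier F"
  using assms by (auto intro!: gen_closed simp: tgens_def)

lemma F_linear_ext:
  assumes "module K V" "linear_on K F V h" "linear_on K F V h'"
    and "\<And>g. g \<in> tgens M N \<Longrightarrow> h (free_gen K g) = h' (free_gen K g)"
    and "x \<in> carrier F"
  shows "h x = h' x"
  by (rule M.free_vs_linear_ext[where S = "tgens M N" and V = V])
    (use assms in \<open>simp_all add: linear_on_pre_tensor pre_tensor_simps\<close>)

lemma pr_linear: "linear_on K F M prM" "linear_on K F N prN"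
  unfolding prM_def prN_def linear_on_pre_tensor atomize_conj
  by (auto intro!: M.lin_ext_linear M.module_axioms N.module_axioms gen_pair_closed)

lemma pr_gen:
  assumes "g \<in> tgens M N"
  shows "prM (free_gen K g) = fst (gen_pair \<mu> \<nu> g)" "prN (free_gen K g) = snd (gen_pair \<mu> \<nu> g)"
  unfolding prM_def prN_def using assms
  by (auto intro!: M.lin_ext_free_gen[where S = "tgens M N"] M.module_axioms N.module_axioms gen_pair_closed)

lemma pr_symbol:
  assumes "m \<in> carrier M" "n \<in> carrier N"
  shows "prM (free_gen K (DotMN m n)) = rdot \<nu> m n" "prM (free_gen K (DotNM n m)) = ldot \<nu> n m"
    "prM (free_gen K (StarMN m n)) = rstar \<nu> m n" "prM (free_gen K (StarNM n m)) = lstar \<nu> n m"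
    "prN (free_gen K (DotMN m n)) = ldot \<mu> m n" "prN (free_gen K (DotNM n m)) = rdot \<mu> n m"
    "prN (free_gen K (StarMN m n)) = lstar \<mu> m n" "prN (free_gen K (StarNM n m)) = rstar \<mu> n m"
  using assms by (simp_all add: pr_gen tgens_def)

lemma pr_closed [simp]: "x \<in> carrier F \<Longrightarrow> prM x \<in> carrier M" "x \<in> carrier F \<Longrightarrow> prN x \<in> carrier N"
  by (auto intro: linear_on_closed[OF pr_linear(1)] linear_on_closed[OF pr_linear(2)])

abbreviation "dotMN m n \<equiv> free_gen K (DotMN m n)"
abbreviation "dotNM n m \<equiv> free_gen K (DotNM n m)"
abbreviation "starMN m n \<equiv> free_gen K (StarMN m n)"
abbreviation "starNM n m \<equiv> free_gen K (StarNM n m)"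

lemma tensor_rels_eq:
  "tensor_rels K M N \<mu> \<nu> =
     bilinearity_rels K F M N dotMN \<union> bilinearity_rels K F M N starMN \<union>
     bilinearity_rels K F N M dotNM \<union> bilinearity_rels K F N M starNM \<union>
     basic_rels F M N \<mu> \<nu> dotMN dotNM starMN starNM \<union>
     action_rels F M N \<mu> dotMN dotNM starMN starNM \<union> action_rels F N M \<nu> dotNM dotMN starNM starMN"
  by (simp add: tensor_rels_def Let_def basic_rels_def basic_pairs_def case_prod_beta)

lemma rels_killed:
  "tensor_rels K M N \<mu> \<nu> \<subseteq> {r \<in> carrier F. prM r = \<zero>\<^bsub>M\<^esub> \<and> prN r = \<zero>\<^bsub>N\<^esub>}"
proof -
  interpret F: module K F by (rule module_F)
  interpret sw: compatible_awbs K N M \<nu> \<mu> by (rule swap)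
  note mods = M.module_axioms N.module_axioms
  note bils = acts_on_bilinear[OF acts(1)] acts_on_bilinear[OF acts(2)]
  have M: "tensor_rels K M N \<mu> \<nu> \<subseteq> {r \<in> carrier F. prM r = \<zero>\<^bsub>M\<^esub>}"
  proof -
    note b = bilinearity_rels_killed[OF module_F M.module_axioms pr_linear(1)]
    have bas: "basic_rels F M N \<mu> \<nu> dotMN dotNM starMN starNM \<subseteq> {r \<in> carrier F. prM r = \<zero>\<^bsub>M\<^esub>}"
      unfolding basic_rels_def
      by (simp add: UN_subset_iff linear_on_minus[OF module_F M.module_axioms pr_linear(1)] pr_symbol
          gen_pair_closed basic_action M.r_neg M.minus_eq)
    show ?thesis
      unfolding tensor_rels_eq
      by (intro Un_least bas b[OF mods bils(6)] b[OF mods bils(8)] b[OF mods(2,1) bils(5)]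
            b[OF mods(2,1) bils(7)] action_rels_killed_left[OF module_F pr_linear(1)]
            sw.action_rels_killed_right[OF module_F pr_linear(1)])
        (simp_all add: pr_symbol)
  qed
  have N: "tensor_rels K M N \<mu> \<nu> \<subseteq> {r \<in> carrier F. prN r = \<zero>\<^bsub>N\<^esub>}"
  proof -
    note b = bilinearity_rels_killed[OF module_F N.module_axioms pr_linear(2)]
    have bas: "basic_rels F M N \<mu> \<nu> dotMN dotNM starMN starNM \<subseteq> {r \<in> carrier F. prN r = \<zero>\<^bsub>N\<^esub>}"
      unfolding basic_rels_def
      by (simp add: UN_subset_iff linear_on_minus[OF module_F N.module_axioms pr_linear(2)] pr_symbol
          gen_pair_closed basic_action N.r_neg N.minus_eq)
    show ?thesis
      unfolding tensor_rels_eq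
      by (intro Un_least bas b[OF mods bils(1)] b[OF mods bils(3)] b[OF mods(2,1) bils(2)]
            b[OF mods(2,1) bils(4)] action_rels_killed_right[OF module_F pr_linear(2)]
            sw.action_rels_killed_left[OF module_F pr_linear(2)])
        (simp_all add: pr_symbol)
  qed
  show ?thesis using M N by blast
qed

lemma R_submodule: "submodule R K F"
  unfolding tensor_ker_def by (rule submodule_hull[OF module_F]) (use rels_killed in blast)

lemma rels_in_R: "tensor_rels K M N \<mu> \<nu> \<subseteq> R"
  unfolding tensor_ker_def by (rule hull_subset)

lemma R_subset: "submodule H K F \<Longrightarrow> tensor_rels K M N \<mu> \<nu> \<subseteq> H \<Longrightarrow> R \<subseteq> H"
  unfolding tensor_ker_def by (rule hull_minimal)

lemma R_killed: "r \<in> R \<Longrightarrow> prM r = \<zero>\<^bsub>M\<^esub>" "r \<in> R \<Longrightarrow> prN r = \<zero>\<^bsub>N\<^esub>"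
proof -
  have "R \<subseteq> {r \<in> carrier F. prM r \<in> {\<zero>\<^bsub>M\<^esub>}}"
    by (rule R_subset[OF linear_on_vimage[OF module_F M.module_axioms pr_linear(1) zero_submodule[OF M.module_axioms]]])
      (use rels_killed in auto)
  moreover have "R \<subseteq> {r \<in> carrier F. prN r \<in> {\<zero>\<^bsub>N\<^esub>}}"
    by (rule R_subset[OF linear_on_vimage[OF module_F N.module_axioms pr_linear(2) zero_submodule[OF N.module_axioms]]])
      (use rels_killed in auto)
  ultimately show "r \<in> R \<Longrightarrow> prM r = \<zero>\<^bsub>M\<^esub>" "r \<in> R \<Longrightarrow> prN r = \<zero>\<^bsub>N\<^esub>" by auto
qed

lemma T_simps:
  "carrier T = a_rcosets\<^bsub>F\<^esub> R" "zero T = R" "add T = set_add F"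
  "smult T = (\<lambda>k X. \<Union>x\<in>X. R +>\<^bsub>F\<^esub> (k \<odot>\<^bsub>F\<^esub> x))"
  "mult T X Y = (\<Union>x\<in>X. \<Union>y\<in>Y. cls (x \<otimes>\<^bsub>F\<^esub> y))"
  "\<lbrace>X, Y\<rbrace>\<^bsub>T\<^esub> = (\<Union>x\<in>X. \<Union>y\<in>Y. cls \<lbrace>x, y\<rbrace>\<^bsub>F\<^esub>)"
  by (simp_all add: tensor_def Let_def cls_def rcoset_mult_def)

lemmas T_quotient = quotient_module[OF module_F R_submodule T_simps(1-4), folded cls_def]

lemma module_T: "module K T" and cls_linear: "linear_on K F T cls" and T_carrier: "carrier T = cls ` carrier F"
  using T_quotient(1-3) by (auto simp: cls_def[abs_def])

lemma cls_eq_iff: "x \<in> carrier F \<Longrightarrow> y \<in> carrier F \<Longrightarrow> cls x = cls y \<longleftrightarrow> x \<ominus>\<^bsub>F\<^esub> y \<in> R"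
  by (rule T_quotient(4))

lemma cls_add: "x \<in> carrier F \<Longrightarrow> y \<in> carrier F \<Longrightarrow> cls x \<oplus>\<^bsub>T\<^esub> cls y = cls (x \<oplus>\<^bsub>F\<^esub> y)"
  and cls_smult: "k \<in> carrier K \<Longrightarrow> x \<in> carrier F \<Longrightarrow> k \<odot>\<^bsub>T\<^esub> cls x = cls (k \<odot>\<^bsub>F\<^esub> x)"
  by (simp_all add: linear_on_add[OF cls_linear] linear_on_smult[OF cls_linear])

lemma cls_closed [simp]: "x \<in> carrier F \<Longrightarrow> cls x \<in> carrier T"
  by (simp add: T_carrier)

lemma pr_cls_cong:
  assumes "x \<in> carrier F" "y \<in> cls x"
  shows "y \<in> carrier F" "prM y = prM x" "prN y = prN x"
proof -
  have y: "y \<in> carrier F" "y \<ominus>\<^bsub>F\<^esub> x \<in> R" using T_quotient(5)[OF assms] by auto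
  then show "y \<in> carrier F" by simp
  have "prM y \<ominus>\<^bsub>M\<^esub> prM x = \<zero>\<^bsub>M\<^esub>" "prN y \<ominus>\<^bsub>N\<^esub> prN x = \<zero>\<^bsub>N\<^esub>"
    using R_killed[OF y(2)] linear_on_minus[OF module_F M.module_axioms pr_linear(1) y(1) assms(1)]
      linear_on_minus[OF module_F N.module_axioms pr_linear(2) y(1) assms(1)] by auto
  then show "prM y = prM x" "prN y = prN x"
    using y(1) assms(1) by (auto intro: minus_zero_imp_eq[OF M.abelian_group_axioms] minus_zero_imp_eq[OF N.abelian_group_axioms])
qed

lemma bilinear_on_T:
  assumes mods: "module K U" "module K V"
    and d: "\<And>u v. \<lbrakk>u \<in> carrier U; v \<in> carrier V\<rbrakk> \<Longrightarrow> d u v \<in> carrier F"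
    and rels: "bilinearity_rels K F U V d \<subseteq> R"
  shows "bilinear_on K U V T (\<lambda>u v. cls (d u v))"
proof -
  interpret F: module K F by (rule module_F)
  interpret U: module K U by fact
  interpret V: module K V by fact
  note in_R = bilinearity_relsI[where K = K and U = U and V = V and F = F and d = d, THEN subsetD[OF rels]]
  have "cls (d (k \<odot>\<^bsub>U\<^esub> u) v) = cls (k \<odot>\<^bsub>F\<^esub> d u v) \<and> cls (d u (k \<odot>\<^bsub>V\<^esub> v)) = cls (k \<odot>\<^bsub>F\<^esub> d u v)"
    if "k \<in> carrier K" "u \<in> carrier U" "v \<in> carrier V" for k u v
    using in_R(1,2)[OF that(2,3,1)] that by (simp add: cls_eq_iff[symmetric] d)
  moreover have "cls (d (u \<oplus>\<^bsub>U\<^esub> u') v) = cls (d u v \<oplus>\<^bsub>F\<^esub> d u' v)"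
    if "u \<in> carrier U" "u' \<in> carrier U" "v \<in> carrier V" for u u' v
    using in_R(3)[OF that(1,3,2)] that by (simp add: cls_eq_iff d)
  moreover have "cls (d u (v \<oplus>\<^bsub>V\<^esub> v')) = cls (d u v \<oplus>\<^bsub>F\<^esub> d u v')"
    if "u \<in> carrier U" "v \<in> carrier V" "v' \<in> carrier V" for u v v'
    using in_R(4)[OF that] that by (simp add: cls_eq_iff d)
  ultimately show ?thesis
    by (simp add: bilinear_on_def cls_add cls_smult d)
qed

definition "dot m n = cls (free_gen K (DotMN m n))"
definition "dot' n m = cls (free_gen K (DotNM n m))"
definition "star m n = cls (free_gen K (StarMN m n))"
definition "star' n m = cls (free_gen K (StarNM n m))"

lemma tensor_bilinear:
  "bilinear_on K M N T dot" "bilinear_on K M N T star" "bilinear_on K N M T dot'" "bilinear_on K N M T star'"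
  unfolding dot_def[abs_def] dot'_def[abs_def] star_def[abs_def] star'_def[abs_def]
  using rels_in_R unfolding tensor_rels_eq
  by (simp_all add: bilinear_on_T M.module_axioms N.module_axioms)

lemma symbols_T_closed [simp]:
  assumes "m \<in> carrier M" "n \<in> carrier N"
  shows "dot m n \<in> carrier T" "dot' n m \<in> carrier T" "star m n \<in> carrier T" "star' n m \<in> carrier T"
  using assms by (simp_all add: dot_def dot'_def star_def star'_def)

lemma dot_mult:
  assumes "m1 \<in> carrier M" "m2 \<in> carrier M" "n \<in> carrier N"
  shows "dot (m1 \<otimes>\<^bsub>M\<^esub> m2) n = dot m1 (ldot \<mu> m2 n)"
    and "star (m1 \<otimes>\<^bsub>M\<^esub> m2) n = dot m1 (lstar \<mu> m2 n) \<oplus>\<^bsub>T\<^esub> dot' (lstar \<mu> m1 n) m2"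
proof -
  interpret F: module K F by (rule module_F)
  have a: "action_rels F M N \<mu> (\<lambda>m n. free_gen K (DotMN m n)) (\<lambda>n m. free_gen K (DotNM n m))
     (\<lambda>m n. free_gen K (StarMN m n)) (\<lambda>n m. free_gen K (StarNM n m)) \<subseteq> R"
    using rels_in_R by (simp add: tensor_rels_eq)
  have "free_gen K (DotMN (m1 \<otimes>\<^bsub>M\<^esub> m2) n) \<ominus>\<^bsub>F\<^esub> free_gen K (DotMN m1 (ldot \<mu> m2 n)) \<in> R"
    "free_gen K (StarMN (m1 \<otimes>\<^bsub>M\<^esub> m2) n) \<ominus>\<^bsub>F\<^esub>
      (free_gen K (DotMN m1 (lstar \<mu> m2 n)) \<oplus>\<^bsub>F\<^esub> free_gen K (DotNM (lstar \<mu> m1 n) m2)) \<in> R"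
    by (rule subsetD[OF a action_relsI(1)[OF assms]] subsetD[OF a action_relsI(2)[OF assms]])+
  then show "dot (m1 \<otimes>\<^bsub>M\<^esub> m2) n = dot m1 (ldot \<mu> m2 n)"
    "star (m1 \<otimes>\<^bsub>M\<^esub> m2) n = dot m1 (lstar \<mu> m2 n) \<oplus>\<^bsub>T\<^esub> dot' (lstar \<mu> m1 n) m2"
    using assms
    by (simp_all add: dot_def dot'_def star_def cls_eq_iff cls_add)
qed

text \<open>
  The relation identifying the two dot symbols of basic pairs is bilinear in the pairs, so it persists
  for linear combinations of basic pairs.
\<close>

lemma dot_basic:
  assumes x: "x \<in> carrier F" and y: "y \<in> carrier F"
  shows "dot (prM x) (prN y) = dot' (prN x) (prM y)"
proof -
  interpret F: module K F by (rule module_F)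
  have gens: "dot (prM (free_gen K g)) (prN (free_gen K h)) = dot' (prN (free_gen K g)) (prM (free_gen K h))"
    if gh: "g \<in> tgens M N" "h \<in> tgens M N" for g h
  proof -
    have "free_gen K (DotMN (fst (gen_pair \<mu> \<nu> g)) (snd (gen_pair \<mu> \<nu> h))) \<ominus>\<^bsub>F\<^esub>
      free_gen K (DotNM (snd (gen_pair \<mu> \<nu> g)) (fst (gen_pair \<mu> \<nu> h))) \<in> tensor_rels K M N \<mu> \<nu>"
      using gh unfolding tensor_rels_eq basic_rels_def by blast
    then show ?thesis
      using gh gen_pair_closed rels_in_R
      by (auto simp: pr_gen dot_def dot'_def cls_eq_iff)
  qed
  note lin = linear_on_comp[OF pr_linear(1) bilinear_on_left[OF tensor_bilinear(1)]]
    linear_on_comp[OF pr_linear(2) bilinear_on_left[OF tensor_bilinear(3)]]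
    linear_on_comp[OF pr_linear(2) bilinear_on_right[OF tensor_bilinear(1)]]
    linear_on_comp[OF pr_linear(1) bilinear_on_right[OF tensor_bilinear(3)]]
  have one: "dot (prM (free_gen K g)) (prN y) = dot' (prN (free_gen K g)) (prM y)" if g: "g \<in> tgens M N" for g
    using gens[OF g] y g
    by (intro F_linear_ext[OF module_T lin(3) lin(4), where x = y]) (simp_all add: gen_closed)
  show ?thesis using x y
    by (intro F_linear_ext[OF module_T lin(1) lin(2), where x = x]) (simp_all add: one)
qed

text \<open>
  One of the compatibility conditions, extended from basic pairs to their linear combinations.
\<close>

lemma rdot_prN:
  assumes x: "x \<in> carrier F" and m: "m \<in> carrier M"
  shows "rdot \<nu> m (prN x) = m \<otimes>\<^bsub>M\<^esub> prM x"
  by (rule F_linear_ext[OF M.module_axioms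
    linear_on_comp[OF pr_linear(2) bilinear_on_right[OF acts_on_bilinear(2)[OF acts(2)] m]]
    linear_on_comp[OF pr_linear(1) bilinear_on_right[OF M.mult_bilinear m]] _ x])
    (simp add: pr_gen basic_action(1)[OF _ m])

text \<open>
  Modulo the relations, the symbols depend bilinearly on their entries.  Hence the bilinear extension of
  a symbol-valued operation on generators collapses to a single symbol, with entries \<open>prM x\<close> and
  \<open>prN y\<close>.
\<close>

lemma cls_lin_ext2:
  assumes b: "bilinear_on K M N T (\<lambda>m n. cls (free_gen K (s m n)))"
    and s: "\<And>m n. m \<in> carrier M \<Longrightarrow> n \<in> carrier N \<Longrightarrow> s m n \<in> tgens M N"
    and x: "x \<in> carrier F" and y: "y \<in> carrier F"
  shows "cls (lin_ext K (free_vs K (tgens M N)) (\<lambda>g. lin_ext K (free_vs K (tgens M N))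
       (\<lambda>h. free_gen K (s (fst (gen_pair \<mu> \<nu> g)) (snd (gen_pair \<mu> \<nu> h)))) y) x)
     = cls (free_gen K (s (prM x) (prN y)))"
proof -
  interpret F: module K F by (rule module_F)
  let ?V = "free_vs K (tgens M N)"
  note clsV = cls_linear[unfolded linear_on_pre_tensor] and modV = M.free_vs_module[of "tgens M N"]
  have in1: "linear_on K ?V ?V (lin_ext K ?V (\<lambda>h. free_gen K (s (fst (gen_pair \<mu> \<nu> g)) (snd (gen_pair \<mu> \<nu> h)))))"
    if "g \<in> tgens M N" for g
    using that by (intro M.lin_ext_linear modV M.free_gen_closed s gen_pair_closed)
  let ?in = "\<lambda>g. lin_ext K ?V (\<lambda>h. free_gen K (s (fst (gen_pair \<mu> \<nu> g)) (snd (gen_pair \<mu> \<nu> h)))) y"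
  have yV: "y \<in> carrier ?V" using y by (simp add: pre_tensor_simps)
  have incl: "?in g \<in> carrier ?V" if "g \<in> tgens M N" for g
    using linear_on_closed[OF in1[OF that] yV] .
  have inner: "cls (?in g) = cls (free_gen K (s (fst (gen_pair \<mu> \<nu> g)) (prN y)))" if g: "g \<in> tgens M N" for g
  proof (rule F_linear_ext[OF module_T _ _ _ y])
    show "linear_on K F T (\<lambda>y. cls (lin_ext K ?V (\<lambda>h. free_gen K (s (fst (gen_pair \<mu> \<nu> g)) (snd (gen_pair \<mu> \<nu> h)))) y))"
      unfolding linear_on_pre_tensor by (rule linear_on_comp[OF in1[OF g] clsV])
    show "linear_on K F T (\<lambda>y. cls (free_gen K (s (fst (gen_pair \<mu> \<nu> g)) (prN y))))"
      using linear_on_comp[OF pr_linear(2) bilinear_on_right[OF b gen_pair_closed(1)[OF g]]] .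
    show "cls (lin_ext K ?V (\<lambda>h. free_gen K (s (fst (gen_pair \<mu> \<nu> g)) (snd (gen_pair \<mu> \<nu> h)))) (free_gen K h))
      = cls (free_gen K (s (fst (gen_pair \<mu> \<nu> g)) (prN (free_gen K h))))" if h: "h \<in> tgens M N" for h
      using g h by (simp add: pr_gen M.lin_ext_free_gen[OF modV, where S = "tgens M N"] M.free_gen_closed s gen_pair_closed)
  qed
  show ?thesis
  proof (rule F_linear_ext[OF module_T _ _ _ x])
    show "linear_on K F T (\<lambda>x. cls (lin_ext K ?V ?in x))"
      unfolding linear_on_pre_tensor
      by (rule linear_on_comp[OF M.lin_ext_linear[OF modV incl] clsV])
    show "linear_on K F T (\<lambda>x. cls (free_gen K (s (prM x) (prN y))))"
      using linear_on_comp[OF pr_linear(1) bilinear_on_left[OF b pr_closed(2)[OF y]]] .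
    show "cls (lin_ext K ?V ?in (free_gen K g)) = cls (free_gen K (s (prM (free_gen K g)) (prN y)))"
      if g: "g \<in> tgens M N" for g
      using g by (simp add: M.lin_ext_free_gen[OF modV incl] inner pr_gen)
  qed
qed

lemma cls_mult_rep:
  assumes x: "x \<in> carrier F" and y: "y \<in> carrier F"
  shows "cls (x \<otimes>\<^bsub>F\<^esub> y) = dot (prM x) (prN y)" "cls \<lbrace>x, y\<rbrace>\<^bsub>F\<^esub> = star (prM x) (prN y)"
proof -
  have "DotMN m n \<in> tgens M N" "StarMN m n \<in> tgens M N" if "m \<in> carrier M" "n \<in> carrier N" for m n
    using that by (auto simp: tgens_def)
  then show "cls (x \<otimes>\<^bsub>F\<^esub> y) = dot (prM x) (prN y)" "cls \<lbrace>x, y\<rbrace>\<^bsub>F\<^esub> = star (prM x) (prN y)"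
    using cls_lin_ext2[of DotMN, OF _ _ x y] cls_lin_ext2[of StarMN, OF _ _ x y] tensor_bilinear(1,2)
    unfolding pre_tensor_simps(5,6) dot_def[abs_def] star_def[abs_def] by blast+
qed

text \<open>
  The union over representatives that defines an operation on cosets is a union of equal sets, because
  \<open>prM\<close> and \<open>prN\<close> do not see the choice of the representatives.
\<close>

lemma T_mult:
  assumes x: "x \<in> carrier F" and y: "y \<in> carrier F"
  shows "cls x \<otimes>\<^bsub>T\<^esub> cls y = dot (prM x) (prN y)" "\<lbrace>cls x, cls y\<rbrace>\<^bsub>T\<^esub> = star (prM x) (prN y)"
proof -
  have self: "x \<in> cls x" "y \<in> cls y" using T_quotient(6) x y by auto
  have "cls (x' \<otimes>\<^bsub>F\<^esub> y') = dot (prM x) (prN y)" "cls \<lbrace>x', y'\<rbrace>\<^bsub>F\<^esub> = star (prM x) (prN y)"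
    if "x' \<in> cls x" "y' \<in> cls y" for x' y'
    using pr_cls_cong[OF x that(1)] pr_cls_cong[OF y that(2)] by (simp_all add: cls_mult_rep)
  then show "cls x \<otimes>\<^bsub>T\<^esub> cls y = dot (prM x) (prN y)" "\<lbrace>cls x, cls y\<rbrace>\<^bsub>T\<^esub> = star (prM x) (prN y)"
    unfolding T_simps using self by (auto simp del: UN_iff)
qed

lemma bilinear_on_T_op:
  assumes b: "bilinear_on K M N T b"
    and op: "\<And>x y. x \<in> carrier F \<Longrightarrow> y \<in> carrier F \<Longrightarrow> op (cls x) (cls y) = b (prM x) (prN y)"
  shows "bilinear_on K T T T op"
proof -
  interpret F: module K F by (rule module_F)
  note bl = bilinear_on_left[OF b] and br = bilinear_on_right[OF b]
  show ?thesis
    unfolding bilinear_on_def T_carrier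
    by (auto simp: cls_add cls_smult op linear_on_add[OF pr_linear(1)] linear_on_add[OF pr_linear(2)]
      linear_on_smult[OF pr_linear(1)] linear_on_smult[OF pr_linear(2)] linear_on_add[OF bl] linear_on_add[OF br]
      linear_on_smult[OF bl] linear_on_smult[OF br] bilinear_on_closed[OF b, unfolded T_carrier])
qed

text \<open>
  The projections of a product \<open>(prM x) \<odot> (prN y)\<close> are its basic pair, whose first component equals
  \<open>(prM x) (prM y)\<close> by compatibility.  Associativity is then the relation for \<open>(m\<^sub>1 m\<^sub>2) \<odot> n\<close>.  The bracket
  axiom is the relation for the bracket symbol of \<open>m\<^sub>1 m\<^sub>2\<close> and \<open>n\<close>; its second summand has its entries in the
  order \<open>N\<close>, \<open>M\<close> and is turned around by \<open>dot_basic\<close>.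
\<close>

lemma awb_T: "awb K T"
proof (intro awb.intro awb_axioms.intro module_T M.field_axioms)
  interpret T: module K T by (rule module_T)
  show "bilinear_on K T T T (mult T)" using bilinear_on_T_op[OF tensor_bilinear(1)] T_mult(1) .
  show "bilinear_on K T T T (bracket T)" using bilinear_on_T_op[OF tensor_bilinear(2)] T_mult(2) .
  have ops: "dot m n = cls (free_gen K (DotMN m n))" "star m n = cls (free_gen K (StarMN m n))" for m n
    by (simp_all add: dot_def star_def)
  fix a b c assume "a \<in> carrier T" "b \<in> carrier T" "c \<in> carrier T"
  then obtain x y z where [simp]: "x \<in> carrier F" "y \<in> carrier F" "z \<in> carrier F"
    and abc: "a = cls x" "b = cls y" "c = cls z" by (auto simp: T_carrier)
  have dot_left: "dot m n \<otimes>\<^bsub>T\<^esub> cls w = dot (rdot \<nu> m n) (prN w)"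
    and dot_left_br: "\<lbrace>dot m n, cls w\<rbrace>\<^bsub>T\<^esub> = star (rdot \<nu> m n) (prN w)"
    and dot_right: "cls w \<otimes>\<^bsub>T\<^esub> dot m n = dot (prM w) (ldot \<mu> m n)"
    and star_left: "star m n \<otimes>\<^bsub>T\<^esub> cls w = dot' (lstar \<mu> m n) (prM w)"
    and star_right: "cls w \<otimes>\<^bsub>T\<^esub> star m n = dot (prM w) (lstar \<mu> m n)"
    if "m \<in> carrier M" "n \<in> carrier N" "w \<in> carrier F" for m n w
    using that by (simp_all add: ops T_mult pr_symbol)
      (metis ops dot_basic pr_symbol symbol_closed)
  show "a \<otimes>\<^bsub>T\<^esub> b \<otimes>\<^bsub>T\<^esub> c = a \<otimes>\<^bsub>T\<^esub> (b \<otimes>\<^bsub>T\<^esub> c)"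
    by (simp add: abc T_mult dot_left dot_right rdot_prN dot_mult)
  show "\<lbrace>a \<otimes>\<^bsub>T\<^esub> b, c\<rbrace>\<^bsub>T\<^esub> = \<lbrace>a, c\<rbrace>\<^bsub>T\<^esub> \<otimes>\<^bsub>T\<^esub> b \<oplus>\<^bsub>T\<^esub> a \<otimes>\<^bsub>T\<^esub> \<lbrace>b, c\<rbrace>\<^bsub>T\<^esub>"
    by (simp add: abc T_mult dot_left_br star_left star_right rdot_prN dot_mult T.a_comm)
qed

end

section \<open>Functoriality\<close>

text \<open>
  The images of relations under an induced map are the relations with entries from the images of \<open>M\<close> and
  \<open>N\<close>, which is expressed by shrinking the carriers of the codomain.  This one formula has two uses: in
  general the images are among the relations of the codomain, and under surjectivity they are all of
  them.
\<close>

lemma bilinearity_rels_image: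
  fixes F :: "('k, 'f) awb" and F' :: "('k, 'f2) awb"
  assumes F: "module K F" "module K F'" and h: "linear_on K F F' h"
    and mods: "module K U" "module K V"
    and lin: "linear_on K U U' \<phi>" "linear_on K V V' \<gamma>"
    and d: "\<And>u v. \<lbrakk>u \<in> carrier U; v \<in> carrier V\<rbrakk> \<Longrightarrow> d u v \<in> carrier F \<and> h (d u v) = e (\<phi> u) (\<gamma> v)"
  shows "h ` bilinearity_rels K F U V d =
    bilinearity_rels K F' (U'\<lparr>carrier := \<phi> ` carrier U\<rparr>) (V'\<lparr>carrier := \<gamma> ` carrier V\<rparr>) e"
proof -
  interpret F: module K F by fact
  interpret U: module K U by fact
  interpret V: module K V by fact
  show ?thesis
    unfolding bilinearity_rels_def
    by (simp add: image_Un image_UN d linear_on_minus[OF F h] linear_on_add[OF h] linear_on_smult[OF h]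
      linear_on_add[OF lin(1), symmetric] linear_on_add[OF lin(2), symmetric]
      linear_on_smult[OF lin(1), symmetric] linear_on_smult[OF lin(2), symmetric] cong: SUP_cong)
qed

lemma bilinearity_rels_mono:
  assumes "A \<subseteq> carrier U" "B \<subseteq> carrier V"
  shows "bilinearity_rels K F (U\<lparr>carrier := A\<rparr>) (V\<lparr>carrier := B\<rparr>) d \<subseteq> bilinearity_rels K F U V d"
  unfolding bilinearity_rels_def using assms
  by (intro Un_mono UN_mono) simp_all

lemma action_rels_mono:
  assumes "A \<subseteq> carrier U" "B \<subseteq> carrier V"
  shows "action_rels F (U\<lparr>carrier := A\<rparr>) (V\<lparr>carrier := B\<rparr>) \<mu> d d' s s' \<subseteq> action_rels F U V \<mu> d d' s s'"
  unfolding action_rels_def using assms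
  by (intro UN_mono) simp_all

lemma tgens_mono: "A \<subseteq> carrier U \<Longrightarrow> B \<subseteq> carrier V \<Longrightarrow> tgens (U\<lparr>carrier := A\<rparr>) (V\<lparr>carrier := B\<rparr>) \<subseteq> tgens U V"
  unfolding tgens_def by (auto intro!: UN_mono)

lemma map_tgen_image:
  "map_tgen \<phi> \<gamma> ` tgens M N = tgens (M'\<lparr>carrier := \<phi> ` carrier M\<rparr>) (N'\<lparr>carrier := \<gamma> ` carrier N\<rparr>)"
  by (simp add: tgens_def image_UN)

lemma basic_rels_mono:
  assumes "A \<subseteq> carrier U" "B \<subseteq> carrier V"
  shows "basic_rels F (U\<lparr>carrier := A\<rparr>) (V\<lparr>carrier := B\<rparr>) \<mu> \<nu> d d' s s' \<subseteq> basic_rels F U V \<mu> \<nu> d d' s s'"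
  unfolding basic_rels_def using tgens_mono[OF assms] by (intro UN_mono) auto

text \<open>
  \<open>A\<close> refers to the domain and \<open>B\<close> to the codomain of the induced map; \<open>push\<close> is that map on the free vector
  spaces.
\<close>

locale tensor_functor = A: compatible_awbs K M N \<mu> \<nu> + B: compatible_awbs K M' N' \<mu>' \<nu>'
  for K :: "('k, 'r) ring_scheme" and M :: "('k, 'm) awb" and N :: "('k, 'n) awb" and \<mu> \<nu>
    and M' :: "('k, 'm2) awb" and N' :: "('k, 'n2) awb" and \<mu>' \<nu>' +
  fixes \<phi> :: "'m \<Rightarrow> 'm2" and \<gamma> :: "'n \<Rightarrow> 'n2"
  assumes hom: "\<phi> \<in> awb_hom K M M'" "\<gamma> \<in> awb_hom K N N'"
    and preserves: "preserves_actions M N \<mu> \<nu> \<mu>' \<nu>' \<phi> \<gamma>"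
begin

definition "push = lin_ext K B.F (\<lambda>g. free_gen K (map_tgen \<phi> \<gamma> g))"

lemma lin: "linear_on K M M' \<phi>" "linear_on K N N' \<gamma>"
  using hom by (auto simp: awb_hom_def linear_on_def)

lemma hom_ops:
  "a \<in> carrier M \<Longrightarrow> b \<in> carrier M \<Longrightarrow> \<phi> (a \<otimes>\<^bsub>M\<^esub> b) = \<phi> a \<otimes>\<^bsub>M'\<^esub> \<phi> b"
  "a \<in> carrier M \<Longrightarrow> b \<in> carrier M \<Longrightarrow> \<phi> \<lbrace>a, b\<rbrace>\<^bsub>M\<^esub> = \<lbrace>\<phi> a, \<phi> b\<rbrace>\<^bsub>M'\<^esub>"
  "x \<in> carrier N \<Longrightarrow> y \<in> carrier N \<Longrightarrow> \<gamma> (x \<otimes>\<^bsub>N\<^esub> y) = \<gamma> x \<otimes>\<^bsub>N'\<^esub> \<gamma> y"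
  "x \<in> carrier N \<Longrightarrow> y \<in> carrier N \<Longrightarrow> \<gamma> \<lbrace>x, y\<rbrace>\<^bsub>N\<^esub> = \<lbrace>\<gamma> x, \<gamma> y\<rbrace>\<^bsub>N'\<^esub>"
  using hom by (auto simp: awb_hom_def)

lemma hom_closed [simp]: "m \<in> carrier M \<Longrightarrow> \<phi> m \<in> carrier M'" "n \<in> carrier N \<Longrightarrow> \<gamma> n \<in> carrier N'"
  by (auto intro: linear_on_closed[OF lin(1)] linear_on_closed[OF lin(2)])

lemma hom_action:
  assumes "m \<in> carrier M" "n \<in> carrier N"
  shows "\<phi> (ldot \<nu> n m) = ldot \<nu>' (\<gamma> n) (\<phi> m)" "\<phi> (rdot \<nu> m n) = rdot \<nu>' (\<phi> m) (\<gamma> n)"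
    "\<phi> (lstar \<nu> n m) = lstar \<nu>' (\<gamma> n) (\<phi> m)" "\<phi> (rstar \<nu> m n) = rstar \<nu>' (\<phi> m) (\<gamma> n)"
    "\<gamma> (ldot \<mu> m n) = ldot \<mu>' (\<phi> m) (\<gamma> n)" "\<gamma> (rdot \<mu> n m) = rdot \<mu>' (\<gamma> n) (\<phi> m)"
    "\<gamma> (lstar \<mu> m n) = lstar \<mu>' (\<phi> m) (\<gamma> n)" "\<gamma> (rstar \<mu> n m) = rstar \<mu>' (\<gamma> n) (\<phi> m)"
  using preserves assms unfolding preserves_actions_def by blast+

lemma map_tgen_closed: "g \<in> tgens M N \<Longrightarrow> map_tgen \<phi> \<gamma> g \<in> tgens M' N'"
  by (force simp: tgens_def)

lemma gen_pair_map:
  "g \<in> tgens M N \<Longrightarrow> fst (gen_pair \<mu>' \<nu>' (map_tgen \<phi> \<gamma> g)) = \<phi> (fst (gen_pair \<mu> \<nu> g))"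
  "g \<in> tgens M N \<Longrightarrow> snd (gen_pair \<mu>' \<nu>' (map_tgen \<phi> \<gamma> g)) = \<gamma> (snd (gen_pair \<mu> \<nu> g))"
  by (auto simp: tgens_def hom_action)

lemma push_linear: "linear_on K A.F B.F push"
  unfolding push_def linear_on_pre_tensor(1)
  by (rule A.M.lin_ext_linear[OF B.module_F B.gen_closed[OF map_tgen_closed]])

lemma push_gen: "g \<in> tgens M N \<Longrightarrow> push (free_gen K g) = free_gen K (map_tgen \<phi> \<gamma> g)"
  unfolding push_def
  by (rule A.M.lin_ext_free_gen[OF B.module_F B.gen_closed[OF map_tgen_closed]])

lemma push_closed [simp]: "x \<in> carrier A.F \<Longrightarrow> push x \<in> carrier B.F"
  by (rule linear_on_closed[OF push_linear])

lemma push_symbol: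
  assumes "m \<in> carrier M" "n \<in> carrier N"
  shows "push (free_gen K (DotMN m n)) = free_gen K (DotMN (\<phi> m) (\<gamma> n))"
    "push (free_gen K (DotNM n m)) = free_gen K (DotNM (\<gamma> n) (\<phi> m))"
    "push (free_gen K (StarMN m n)) = free_gen K (StarMN (\<phi> m) (\<gamma> n))"
    "push (free_gen K (StarNM n m)) = free_gen K (StarNM (\<gamma> n) (\<phi> m))"
  using assms by (simp_all add: push_gen tgens_def)

lemma rels_image:
  defines "M'' \<equiv> M'\<lparr>carrier := \<phi> ` carrier M\<rparr>" and "N'' \<equiv> N'\<lparr>carrier := \<gamma> ` carrier N\<rparr>"
  shows "push ` tensor_rels K M N \<mu> \<nu> =
     bilinearity_rels K B.F M'' N'' B.dotMN \<union> bilinearity_rels K B.F M'' N'' B.starMN \<union>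
     bilinearity_rels K B.F N'' M'' B.dotNM \<union> bilinearity_rels K B.F N'' M'' B.starNM \<union>
     basic_rels B.F M'' N'' \<mu>' \<nu>' B.dotMN B.dotNM B.starMN B.starNM \<union>
     action_rels B.F M'' N'' \<mu>' B.dotMN B.dotNM B.starMN B.starNM \<union>
     action_rels B.F N'' M'' \<nu>' B.dotNM B.dotMN B.starNM B.starMN"
proof -
  interpret F: module K A.F by (rule A.module_F)
  interpret sw: compatible_awbs K N M \<nu> \<mu> by (rule A.swap)
  note mods = A.M.module_axioms A.N.module_axioms
  note bil = bilinearity_rels_image[OF A.module_F B.module_F push_linear mods lin]
    bilinearity_rels_image[OF A.module_F B.module_F push_linear mods(2,1) lin(2,1)]
  note push_simps = linear_on_minus[OF A.module_F B.module_F push_linear] linear_on_add[OF push_linear] push_symbol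
  have bas: "push ` basic_rels A.F M N \<mu> \<nu> A.dotMN A.dotNM A.starMN A.starNM =
     basic_rels B.F M'' N'' \<mu>' \<nu>' B.dotMN B.dotNM B.starMN B.starNM"
    unfolding basic_rels_def M''_def N''_def map_tgen_image[symmetric]
    by (simp add: image_UN push_simps A.gen_pair_closed gen_pair_map cong: SUP_cong)
  have act: "push ` action_rels A.F M N \<mu> A.dotMN A.dotNM A.starMN A.starNM =
     action_rels B.F M'' N'' \<mu>' B.dotMN B.dotNM B.starMN B.starNM"
    unfolding action_rels_def M''_def N''_def
    by (simp add: image_UN push_simps hom_ops hom_action cong: SUP_cong)
  have act': "push ` action_rels A.F N M \<nu> A.dotNM A.dotMN A.starNM A.starMN =
     action_rels B.F N'' M'' \<nu>' B.dotNM B.dotMN B.starNM B.starMN"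
    unfolding action_rels_def M''_def N''_def
    by (simp add: image_UN push_simps hom_ops hom_action cong: SUP_cong)
  have b: "push ` bilinearity_rels K A.F M N A.dotMN = bilinearity_rels K B.F M'' N'' B.dotMN"
    "push ` bilinearity_rels K A.F M N A.starMN = bilinearity_rels K B.F M'' N'' B.starMN"
    "push ` bilinearity_rels K A.F N M A.dotNM = bilinearity_rels K B.F N'' M'' B.dotNM"
    "push ` bilinearity_rels K A.F N M A.starNM = bilinearity_rels K B.F N'' M'' B.starNM"
    unfolding M''_def N''_def
    by (rule bil, simp add: push_symbol)+
  show ?thesis
    unfolding A.tensor_rels_eq image_Un bas act act' b ..
qed

lemma push_rels: "push ` tensor_rels K M N \<mu> \<nu> \<subseteq> tensor_rels K M' N' \<mu>' \<nu>'"
proof -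
  have s: "\<phi> ` carrier M \<subseteq> carrier M'" "\<gamma> ` carrier N \<subseteq> carrier N'" by auto
  show ?thesis unfolding rels_image B.tensor_rels_eq
    by (intro Un_mono bilinearity_rels_mono basic_rels_mono action_rels_mono s)
qed

lemma push_rels_surj:
  assumes "\<phi> ` carrier M = carrier M'" "\<gamma> ` carrier N = carrier N'"
  shows "push ` tensor_rels K M N \<mu> \<nu> = tensor_rels K M' N' \<mu>' \<nu>'"
  unfolding rels_image B.tensor_rels_eq assms by simp

lemma push_R: "r \<in> A.R \<Longrightarrow> push r \<in> B.R"
proof -
  have "tensor_rels K M N \<mu> \<nu> \<subseteq> {x \<in> carrier A.F. push x \<in> B.R}"
    using push_rels B.rels_in_R A.rels_killed by blast
  then have "A.R \<subseteq> {x \<in> carrier A.F. push x \<in> B.R}"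
    by (rule A.R_subset[OF linear_on_vimage[OF A.module_F B.module_F push_linear B.R_submodule]])
  then show "r \<in> A.R \<Longrightarrow> push r \<in> B.R" by blast
qed

text \<open>
  The image of \<open>R\<close> is a subspace that contains all relations of the codomain, as these lift.
\<close>

lemma push_R_surj:
  assumes "\<phi> ` carrier M = carrier M'" "\<gamma> ` carrier N = carrier N'"
  shows "B.R \<subseteq> push ` A.R"
  by (rule B.R_subset[OF linear_on_image[OF A.module_F B.module_F push_linear A.R_submodule]])
    (use push_rels_surj[OF assms] image_mono[OF A.rels_in_R, of push] in simp)

lemma push_surj:
  assumes "\<phi> ` carrier M = carrier M'" "\<gamma> ` carrier N = carrier N'"
  shows "push ` carrier A.F = carrier B.F"
proof
  interpret F: module K A.F by (rule A.module_F)
  have g: "map_tgen \<phi> \<gamma> ` tgens M N = tgens M' N'"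
    unfolding map_tgen_image[where M' = M' and N' = N'] assms by simp
  have "submodule (push ` carrier A.F) K B.F"
    by (rule linear_on_image[OF A.module_F B.module_F push_linear F.carrier_is_submodule])
  have "submodule (push ` carrier A.F) K (free_vs K (tgens M' N'))"
    by (intro submodule_cong[OF B.module_F _ _ _ _ \<open>submodule (push ` carrier A.F) K B.F\<close>])
      (simp_all only: pre_tensor_simps)
  then show "carrier B.F \<subseteq> push ` carrier A.F"
    unfolding pre_tensor_simps(1)[of K M' N']
  proof (rule A.M.free_vs_subset_submodule)
    fix g' assume "g' \<in> tgens M' N'"
    then obtain x where "x \<in> tgens M N" "g' = map_tgen \<phi> \<gamma> x" using g by blast
    then show "free_gen K g' \<in> push ` carrier A.F"
      by (metis push_gen A.gen_closed imageI)
  qed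
qed (simp add: image_subset_iff)

abbreviation "tmap \<equiv> tensor_map K M' N' \<mu>' \<nu>' \<phi> \<gamma>"

lemma tmap_cls:
  assumes x: "x \<in> carrier A.F"
  shows "tmap (A.cls x) = B.cls (push x)"
proof -
  have "B.cls (push y) = B.cls (push x)" if y: "y \<in> A.cls x" for y
  proof -
    have y: "y \<in> carrier A.F" "y \<ominus>\<^bsub>A.F\<^esub> x \<in> A.R" using A.T_quotient(5)[OF x y] by auto
    then have "push y \<ominus>\<^bsub>B.F\<^esub> push x \<in> B.R"
      using push_R[OF y(2)] linear_on_minus[OF A.module_F B.module_F push_linear y(1) x] by simp
    then show ?thesis using x y by (simp add: B.cls_eq_iff)
  qed
  moreover have "tmap (A.cls x) = (\<Union>y\<in>A.cls x. B.cls (push y))"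
    by (simp add: tensor_map_def Let_def push_def B.cls_def)
  ultimately have "tmap (A.cls x) = (\<Union>y\<in>A.cls x. B.cls (push x))" by (simp cong: SUP_cong)
  then show ?thesis using A.T_quotient(6)[OF x] by (metis UN_constant empty_iff)
qed

lemma pr_push:
  assumes "x \<in> carrier A.F"
  shows "B.prM (push x) = \<phi> (A.prM x)" "B.prN (push x) = \<gamma> (A.prN x)"
proof -
  show "B.prM (push x) = \<phi> (A.prM x)"
    by (rule A.F_linear_ext[OF B.M.module_axioms linear_on_comp[OF push_linear B.pr_linear(1)]
          linear_on_comp[OF A.pr_linear(1) lin(1)] _ assms])
      (simp add: push_gen A.pr_gen B.pr_gen map_tgen_closed gen_pair_map)
  show "B.prN (push x) = \<gamma> (A.prN x)"
    by (rule A.F_linear_ext[OF B.N.module_axioms linear_on_comp[OF push_linear B.pr_linear(2)]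
          linear_on_comp[OF A.pr_linear(2) lin(2)] _ assms])
      (simp add: push_gen A.pr_gen B.pr_gen map_tgen_closed gen_pair_map)
qed

lemma tmap_symbol:
  assumes "m \<in> carrier M" "n \<in> carrier N"
  shows "tmap (A.dot m n) = B.dot (\<phi> m) (\<gamma> n)" "tmap (A.star m n) = B.star (\<phi> m) (\<gamma> n)"
  using assms by (simp_all add: A.dot_def A.star_def B.dot_def B.star_def tmap_cls push_symbol)

lemma tmap_hom: "tmap \<in> awb_hom K A.T B.T"
proof -
  interpret F: module K A.F by (rule A.module_F)
  have "tmap (A.cls x) \<in> carrier B.T" if "x \<in> carrier A.F" for x
    using that by (simp add: tmap_cls)
  moreover have "tmap (A.cls x \<oplus>\<^bsub>A.T\<^esub> A.cls y) = tmap (A.cls x) \<oplus>\<^bsub>B.T\<^esub> tmap (A.cls y)"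
    if "x \<in> carrier A.F" "y \<in> carrier A.F" for x y
    using that
    by (simp add: A.cls_add linear_on_add[OF push_linear]
        linear_on_add[OF B.cls_linear] tmap_cls)
  moreover have "tmap (k \<odot>\<^bsub>A.T\<^esub> A.cls x) = k \<odot>\<^bsub>B.T\<^esub> tmap (A.cls x)"
    if "k \<in> carrier K" "x \<in> carrier A.F" for k x
    using that by (simp add: A.cls_smult tmap_cls
        linear_on_smult[OF push_linear] linear_on_smult[OF B.cls_linear])
  moreover have "tmap (A.cls x \<otimes>\<^bsub>A.T\<^esub> A.cls y) = tmap (A.cls x) \<otimes>\<^bsub>B.T\<^esub> tmap (A.cls y)"
    "tmap \<lbrace>A.cls x, A.cls y\<rbrace>\<^bsub>A.T\<^esub> = \<lbrace>tmap (A.cls x), tmap (A.cls y)\<rbrace>\<^bsub>B.T\<^esub>"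
    if "x \<in> carrier A.F" "y \<in> carrier A.F" for x y
    using that by (simp_all add: tmap_cls A.T_mult B.T_mult pr_push tmap_symbol)
  ultimately show ?thesis
    unfolding awb_hom_def A.T_carrier by (simp add: Pi_iff)
qed

lemma tmap_surj:
  assumes "\<phi> ` carrier M = carrier M'" "\<gamma> ` carrier N = carrier N'"
  shows "tmap ` carrier A.T = carrier B.T"
  unfolding A.T_carrier B.T_carrier push_surj[OF assms, symmetric] image_image
  by (rule image_cong) (simp_all add: tmap_cls)

end

section \<open>Right exactness\<close>

lemma a_kernel_eq: "a_kernel A B h = {x \<in> carrier A. h x = \<zero>\<^bsub>B\<^esub>}"
  by (simp add: a_kernel_def kernel_def)

text \<open>
  The map \<open>lift\<close> built from a set-theoretic section of \<open>g\<close> is linear on the free vector spaces, although it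
  need not respect the relations.  The defect \<open>D x\<close> of \<open>x\<close> from being the lift of its image always lies in the
  image \<open>J\<close> of the first tensor product, since it does so on symbols.  An element of the kernel can be
  represented by some \<open>y\<close> with zero image in the third free vector space, so its class is its own defect.
\<close>

lemma tensor_kernel_subset_image:
  assumes f: "tensor_functor K M1 N \<mu>1 \<nu>1 M2 N \<mu>2 \<nu>2 f id"
    and g: "tensor_functor K M2 N \<mu>2 \<nu>2 M3 N \<mu>3 \<nu>3 g id"
    and exact: "f ` carrier M1 = a_kernel M2 M3 g" and surj: "g ` carrier M2 = carrier M3"
  shows "a_kernel (tensor K M2 N \<mu>2 \<nu>2) (tensor K M3 N \<mu>3 \<nu>3) (tensor_map K M3 N \<mu>3 \<nu>3 g id)
    \<subseteq> tensor_map K M2 N \<mu>2 \<nu>2 f id ` carrier (tensor K M1 N \<mu>1 \<nu>1)"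
proof
  interpret f: tensor_functor K M1 N \<mu>1 \<nu>1 M2 N \<mu>2 \<nu>2 f id by fact
  interpret g: tensor_functor K M2 N \<mu>2 \<nu>2 M3 N \<mu>3 \<nu>3 g id by fact
  \<comment> \<open>the codomain of \<open>f\<close> is the domain of \<open>g\<close>; its instance is addressed as \<open>f.B\<close>\<close>
  interpret F1: module K f.A.F by (rule f.A.module_F)
  interpret F2: module K f.B.F by (rule f.B.module_F)
  interpret T2: module K f.B.T by (rule f.B.module_T)
  define J where "J = (\<lambda>x. f.B.cls (f.push x)) ` carrier f.A.F"
  have J: "submodule J K f.B.T" unfolding J_def
    by (rule linear_on_image[OF f.A.module_F f.B.module_T
          linear_on_comp[OF f.push_linear f.B.cls_linear] F1.carrier_is_submodule])
  define \<sigma> where "\<sigma> = inv_into (carrier M2) g"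
  have \<sigma>: "\<sigma> m \<in> carrier M2" "g (\<sigma> m) = m" if "m \<in> carrier M3" for m
    using that surj by (auto simp: \<sigma>_def inv_into_into f_inv_into_f)
  have \<sigma>_gen: "map_tgen \<sigma> id h \<in> tgens M2 N" if "h \<in> tgens M3 N" for h
    using that \<sigma>(1) by (force simp: tgens_def)
  define lift where "lift = lin_ext K f.B.F (\<lambda>h. free_gen K (map_tgen \<sigma> id h))"
  have lift_linear: "linear_on K g.B.F f.B.F lift"
    unfolding lift_def linear_on_pre_tensor(1)
    by (rule f.A.M.lin_ext_linear[OF f.B.module_F f.B.gen_closed[OF \<sigma>_gen]])
  have lift_gen: "lift (free_gen K h) = free_gen K (map_tgen \<sigma> id h)" if "h \<in> tgens M3 N" for h
    unfolding lift_def
    by (rule f.A.M.lin_ext_free_gen[OF f.B.module_F f.B.gen_closed[OF \<sigma>_gen] that])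
  define D where "D x = f.B.cls x \<ominus>\<^bsub>f.B.T\<^esub> f.B.cls (lift (g.push x))" for x
  have D_linear: "linear_on K f.B.F f.B.T D"
    unfolding D_def[abs_def]
    by (rule linear_on_diff[OF f.B.module_T f.B.cls_linear
      linear_on_comp[OF linear_on_comp[OF g.push_linear lift_linear] f.B.cls_linear]])
  \<comment> \<open>\<open>m\<close> and \<open>\<sigma> (g m)\<close> have the same image under \<open>g\<close>, so exactness writes their difference as some \<open>f a\<close>\<close>
  have defect: "\<exists>a\<in>carrier M1. m \<ominus>\<^bsub>M2\<^esub> \<sigma> (g m) = f a" if m: "m \<in> carrier M2" for m
  proof -
    have s: "\<sigma> (g m) \<in> carrier M2" "g (\<sigma> (g m)) = g m" using \<sigma> m by simp_all
    then have "g (m \<ominus>\<^bsub>M2\<^esub> \<sigma> (g m)) = \<zero>\<^bsub>M3\<^esub>"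
      using m linear_on_minus[OF f.B.M.module_axioms g.B.M.module_axioms g.lin(1) m s(1)]
      by (simp add: g.B.M.r_neg g.B.M.minus_eq)
    then have "m \<ominus>\<^bsub>M2\<^esub> \<sigma> (g m) \<in> a_kernel M2 M3 g" using m s(1) by (simp add: a_kernel_eq)
    then show ?thesis unfolding exact[symmetric] by blast
  qed
  have D_gen: "D (free_gen K h) \<in> J" if h: "h \<in> tgens M2 N" for h
  proof -
    obtain m n where m: "m \<in> carrier M2" and n: "n \<in> carrier N"
      and hs: "h \<in> {DotMN m n, DotNM n m, StarMN m n, StarNM n m}"
      using h by (auto simp: tgens_def)
    obtain a where a: "a \<in> carrier M1" "m \<ominus>\<^bsub>M2\<^esub> \<sigma> (g m) = f a" using defect[OF m] by blast
    have s: "\<sigma> (g m) \<in> carrier M2" using \<sigma> m by simp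
    have D: "D (free_gen K h) = f.B.cls (free_gen K h) \<ominus>\<^bsub>f.B.T\<^esub> f.B.cls (free_gen K (map_tgen \<sigma> id (map_tgen g id h)))"
      using h by (simp add: D_def g.push_gen lift_gen g.map_tgen_closed)
    note left = T2.bilinear_on_minus_left[OF _ f.B.M.module_axioms m s n]
      and right = T2.bilinear_on_minus_right[OF _ f.B.M.module_axioms n m s]
    note d = left[OF f.B.tensor_bilinear(1)] left[OF f.B.tensor_bilinear(2)]
      right[OF f.B.tensor_bilinear(3)] right[OF f.B.tensor_bilinear(4)]
    note d' = d[unfolded a(2) f.B.dot_def f.B.star_def f.B.dot'_def f.B.star'_def]
    have "D (free_gen K h) \<in> {f.B.cls (f.push (free_gen K (DotMN a n))), f.B.cls (f.push (free_gen K (DotNM n a))),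
        f.B.cls (f.push (free_gen K (StarMN a n))), f.B.cls (f.push (free_gen K (StarNM n a)))}"
      using hs d' a(1) n by (auto simp: D f.push_symbol)
    moreover have "\<dots> \<subseteq> J" using a(1) n by (auto simp: J_def intro!: imageI)
    ultimately show ?thesis by blast
  qed
  have D_in_J: "D x \<in> J" if x: "x \<in> carrier f.B.F" for x
  proof -
    have sub: "submodule {x \<in> carrier f.B.F. D x \<in> J} K f.B.F"
      by (rule linear_on_vimage[OF f.B.module_F f.B.module_T D_linear J])
    have "submodule {x \<in> carrier f.B.F. D x \<in> J} K (free_vs K (tgens M2 N))"
      by (rule submodule_cong[OF f.B.module_F _ _ _ _ sub]) (simp_all only: pre_tensor_simps)
    then have "carrier (free_vs K (tgens M2 N)) \<subseteq> {x \<in> carrier f.B.F. D x \<in> J}"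
      by (rule f.A.M.free_vs_subset_submodule) (simp add: D_gen f.B.gen_closed)
    then show ?thesis using x by (auto simp: pre_tensor_simps)
  qed
  fix X assume "X \<in> a_kernel f.B.T g.B.T g.tmap"
  then have "X \<in> carrier f.B.T" and X0: "g.tmap X = g.B.R"
    by (simp_all add: a_kernel_eq g.B.T_simps(2))
  then obtain x where x: "x \<in> carrier f.B.F" "X = f.B.cls x"
    unfolding f.B.T_carrier by blast
  have "g.B.cls (g.push x) = g.B.R" using X0 unfolding x(2) g.tmap_cls[OF x(1)] .
  then have "g.push x \<in> g.B.R" using g.B.T_quotient(6)[OF g.push_closed[OF x(1)]] by simp
  then obtain r where r: "r \<in> f.B.R" "g.push x = g.push r"
    using g.push_R_surj[OF surj] by (simp add: image_id) blast
  have rc: "r \<in> carrier f.B.F" using r(1) F2.submoduleE(1)[OF f.B.R_submodule] by blast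
  \<comment> \<open>subtracting \<open>r\<close> keeps the class of \<open>x\<close> and makes its image vanish already in the free vector space\<close>
  define y where "y = x \<ominus>\<^bsub>f.B.F\<^esub> r"
  have y: "y \<in> carrier f.B.F" using x(1) rc by (simp add: y_def)
  have "g.push y = \<zero>\<^bsub>g.B.F\<^esub>"
    using linear_on_minus[OF f.B.module_F g.B.module_F g.push_linear x(1) rc] r(2) rc
      module.axioms(2)[OF g.B.module_F]
    by (simp add: y_def abelian_group.r_neg abelian_group.minus_eq)
  then have "D y = f.B.cls y"
    using y linear_on_zero[OF g.B.module_F f.B.module_F lift_linear]
      linear_on_zero[OF f.B.module_F f.B.module_T f.B.cls_linear] f.B.cls_closed[OF y]
    by (simp add: D_def T2.minus_eq)
  moreover have "f.B.cls y = X"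
  proof -
    have "y \<ominus>\<^bsub>f.B.F\<^esub> x = \<ominus>\<^bsub>f.B.F\<^esub> r"
      using x(1) rc
      by (simp add: y_def F2.minus_eq F2.a_comm[of x "\<ominus>\<^bsub>f.B.F\<^esub> r"] F2.a_assoc F2.r_neg)
    then show ?thesis using r(1) y x(1,2) F2.submoduleE(3)[OF f.B.R_submodule] by (simp add: f.B.cls_eq_iff)
  qed
  ultimately have "X \<in> J" using D_in_J[OF y] by simp
  then show "X \<in> f.tmap ` carrier f.A.T"
    unfolding J_def f.A.T_carrier image_image by (simp add: f.tmap_cls cong: image_cong)
qed

text \<open>
  On symbols the composite replaces the entry from \<open>M1\<close> by \<open>g (f a) = \<zero>\<close>, and a symbol with a zero entry
  vanishes by bilinearity.
\<close>

lemma tensor_image_subset_kernel: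
  assumes f: "tensor_functor K M1 N \<mu>1 \<nu>1 M2 N \<mu>2 \<nu>2 f id"
    and g: "tensor_functor K M2 N \<mu>2 \<nu>2 M3 N \<mu>3 \<nu>3 g id"
    and gf: "\<And>a. a \<in> carrier M1 \<Longrightarrow> g (f a) = \<zero>\<^bsub>M3\<^esub>"
  shows "tensor_map K M2 N \<mu>2 \<nu>2 f id ` carrier (tensor K M1 N \<mu>1 \<nu>1)
    \<subseteq> a_kernel (tensor K M2 N \<mu>2 \<nu>2) (tensor K M3 N \<mu>3 \<nu>3) (tensor_map K M3 N \<mu>3 \<nu>3 g id)"
proof -
  interpret f: tensor_functor K M1 N \<mu>1 \<nu>1 M2 N \<mu>2 \<nu>2 f id by fact
  interpret g: tensor_functor K M2 N \<mu>2 \<nu>2 M3 N \<mu>3 \<nu>3 g id by fact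
  interpret T3: module K g.B.T by (rule g.B.module_T)
  have zero_linear: "linear_on K f.A.F g.B.T (\<lambda>x. \<zero>\<^bsub>g.B.T\<^esub>)"
    by (rule linear_onI) simp_all
  have gens: "g.B.cls (g.push (f.push (free_gen K h))) = \<zero>\<^bsub>g.B.T\<^esub>" if h: "h \<in> tgens M1 N" for h
  proof -
    obtain a n where a: "a \<in> carrier M1" and n: "n \<in> carrier N"
      and hs: "h \<in> {DotMN a n, DotNM n a, StarMN a n, StarNM n a}"
      using h by (auto simp: tgens_def)
    note left = linear_on_zero[OF g.B.M.module_axioms g.B.module_T bilinear_on_left[OF _ n]]
      and right = linear_on_zero[OF g.B.M.module_axioms g.B.module_T bilinear_on_right[OF _ n]]
    note z = left[OF g.B.tensor_bilinear(1)] left[OF g.B.tensor_bilinear(2)]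
      right[OF g.B.tensor_bilinear(3)] right[OF g.B.tensor_bilinear(4)]
    show ?thesis
      using hs z[unfolded g.B.dot_def g.B.star_def g.B.dot'_def g.B.star'_def] a n
      by (auto simp: f.push_symbol g.push_symbol gf)
  qed
  have "g.B.cls (g.push (f.push x)) = \<zero>\<^bsub>g.B.T\<^esub>" if x: "x \<in> carrier f.A.F" for x
    by (rule f.A.F_linear_ext[OF g.B.module_T linear_on_comp[OF linear_on_comp[OF f.push_linear g.push_linear]
            g.B.cls_linear] zero_linear gens x])
  then show ?thesis
    by (auto simp: a_kernel_eq f.A.T_carrier f.tmap_cls g.tmap_cls)
qed

theorem theorem4p6:
  fixes K :: "('k, 'r) ring_scheme"
    and M1 :: "('k, 'a) awb" and M2 :: "('k, 'b) awb" and M3 :: "('k, 'c) awb"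
    and N :: "('k, 'n) awb"
    and f :: "'a \<Rightarrow> 'b" and g :: "'b \<Rightarrow> 'c"
    and \<mu>1 :: "('a, 'n) awb_action" and \<nu>1 :: "('n, 'a) awb_action"
    and \<mu>2 :: "('b, 'n) awb_action" and \<nu>2 :: "('n, 'b) awb_action"
    and \<mu>3 :: "('c, 'n) awb_action" and \<nu>3 :: "('n, 'c) awb_action"
  assumes "field K"
    and "awb_short_exact K M1 M2 M3 f g"
    and "awb K N"
    and "compatible_actions K M1 N \<mu>1 \<nu>1"
    and "compatible_actions K M2 N \<mu>2 \<nu>2"
    and "compatible_actions K M3 N \<mu>3 \<nu>3"
    and "preserves_actions M1 N \<mu>1 \<nu>1 \<mu>2 \<nu>2 f id"
    and "preserves_actions M2 N \<mu>2 \<nu>2 \<mu>3 \<nu>3 g id"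
  shows "awb_right_exact K
    (tensor K M1 N \<mu>1 \<nu>1) (tensor K M2 N \<mu>2 \<nu>2) (tensor K M3 N \<mu>3 \<nu>3)
    (tensor_map K M2 N \<mu>2 \<nu>2 f id) (tensor_map K M3 N \<mu>3 \<nu>3 g id)"
proof -
  have awb: "awb K M1" "awb K M2" "awb K M3" and hom: "f \<in> awb_hom K M1 M2" "g \<in> awb_hom K M2 M3"
    and exact: "f ` carrier M1 = a_kernel M2 M3 g" and surj: "g ` carrier M2 = carrier M3"
    using assms(2) by (auto simp: awb_short_exact_def awb_right_exact_def)
  have idN: "id \<in> awb_hom K N N" by (simp add: awb_hom_def)
  have f: "tensor_functor K M1 N \<mu>1 \<nu>1 M2 N \<mu>2 \<nu>2 f id"
    using assms(3-5,7) awb hom idN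
    by (intro tensor_functor.intro tensor_functor_axioms.intro compatible_awbs.intro compatible_awbs_axioms.intro)
  have g: "tensor_functor K M2 N \<mu>2 \<nu>2 M3 N \<mu>3 \<nu>3 g id"
    using assms(3,5,6,8) awb hom idN
    by (intro tensor_functor.intro tensor_functor_axioms.intro compatible_awbs.intro compatible_awbs_axioms.intro)
  interpret f: tensor_functor K M1 N \<mu>1 \<nu>1 M2 N \<mu>2 \<nu>2 f id by (rule f)
  interpret g: tensor_functor K M2 N \<mu>2 \<nu>2 M3 N \<mu>3 \<nu>3 g id by (rule g)
  have "g (f a) = \<zero>\<^bsub>M3\<^esub>" if "a \<in> carrier M1" for a
    using exact that by (auto simp: a_kernel_eq)
  then have "f.tmap ` carrier f.A.T = a_kernel f.B.T g.B.T g.tmap"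
    using tensor_kernel_subset_image[OF f g exact surj] tensor_image_subset_kernel[OF f g] by blast
  moreover have "g.tmap ` carrier f.B.T = carrier g.B.T" by (rule g.tmap_surj[OF surj]) simp
  ultimately show ?thesis
    using f.A.awb_T f.B.awb_T g.B.awb_T f.tmap_hom g.tmap_hom by (simp add: awb_right_exact_def)
qed

end
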